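(* Let $R$ be a commutative local Noetherian ring of dimension $d$. If $R$ is not Cohen-Macaulay, then for any system of parameters $a_1,\ldots,a_d$ of $R$ there exist positive integers $n_1,\ldots,n_d,N_1,\ldots,N_d$ with $n_i\leq N_i$ for $i=1,\ldots,d$ such that the $R/(a_1^{n_1},\ldots,a_d^{n_d})$-module $$\operatorname{Hom}_R\bigl(R/(a_1^{n_1},\ldots,a_d^{n_d}),\,R/(a_1^{N_1},\ldots,a_d^{N_d})\bigr)$$ is decomposable and not free.
   Context: Let $\mathfrak{m}$ be the maximal ideal of $R$. A system of parameters of a local ring $R$ of dimension $d$ is a set of $d$ elements of $\mathfrak{m}$ generating an ideal $\mathfrak{a}$ such that $R/\mathfrak{a}$ has finite length. A module is decomposable if it is the direct sum of two nonzero submodules. "Not free" means not free as a module over $R/(a_1^{n_1},\ldots,a_d^{n_d})$. *)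

theory Defs
  imports "HOL-Algebra.Ring_Divisibility" "HOL-Algebra.Module" "HOL-Library.Extended_Nat"
begin

section \<open>Local rings and Krull dimension\<close>

definition local_ring :: "('a, 'r) ring_scheme \<Rightarrow> bool" where
  "local_ring R \<longleftrightarrow> cring R \<and> (\<exists>!m. maximalideal m R)"

definition max_ideal :: "('a, 'r) ring_scheme \<Rightarrow> 'a set" where
  "max_ideal R = (THE m. maximalideal m R)"

definition krull_dim :: "('a, 'r) ring_scheme \<Rightarrow> enat" where
  "krull_dim R = Sup {enat l | l. \<exists>P :: nat \<Rightarrow> 'a set.
     (\<forall>i\<le>l. primeideal (P i) R) \<and> (\<forall>i<l. P i \<subset> P (Suc i))}"


section \<open>Modules\<close>

text \<open>
  A module record extends a ring record. The multiplication and unit fields play no role in the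
  locale \<^locale>\<open>module\<close>; where no product is available they are left undefined.
\<close>

definition quot_module :: "('a, 'r) ring_scheme \<Rightarrow> 'a set \<Rightarrow> ('a, 'a set) module" where
  "quot_module R I =
     ring.extend (R Quot I) (module.fields (\<lambda>r K. (I +>\<^bsub>R\<^esub> r) \<otimes>\<^bsub>R Quot I\<^esub> K))"

text \<open>
  Functions are extensional (undefined outside the carrier), so that equality of elements of the
  Hom module is equality of maps.
\<close>

definition hom_module ::
  "('a, 'r) ring_scheme \<Rightarrow> ('a, 'b, 'm) module_scheme \<Rightarrow> ('a, 'c, 'n) module_scheme
     \<Rightarrow> ('a, 'b \<Rightarrow> 'c) module" where
  "hom_module R M N =
     \<lparr> carrier = {f \<in> carrier M \<rightarrow>\<^sub>E carrier N.
                  (\<forall>x\<in>carrier M. \<forall>y\<in>carrier M. f (x \<oplus>\<^bsub>M\<^esub> y) = f x \<oplus>\<^bsub>N\<^esub> f y) \<and>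
                  (\<forall>r\<in>carrier R. \<forall>x\<in>carrier M. f (r \<odot>\<^bsub>M\<^esub> x) = r \<odot>\<^bsub>N\<^esub> f x)},
       mult = undefined, one = undefined,
       zero = (\<lambda>x\<in>carrier M. \<zero>\<^bsub>N\<^esub>),
       add = (\<lambda>f g. \<lambda>x\<in>carrier M. f x \<oplus>\<^bsub>N\<^esub> g x),
       smult = (\<lambda>r f. \<lambda>x\<in>carrier M. r \<odot>\<^bsub>N\<^esub> f x) \<rparr>"

text \<open>
  An \<open>R\<close>-module annihilated by an ideal \<open>I\<close>, regarded as a module over \<open>R Quot I\<close>: a coset acts
  through any of its representatives. See \<open>descend_module\<close> and \<open>descend_smult\<close> below.
\<close>

definition descend :: "('a, 'b, 'm) module_scheme \<Rightarrow> ('a set, 'b) module" where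
  "descend M =
     \<lparr> carrier = carrier M, mult = mult M, one = one M, zero = zero M, add = add M,
       smult = (\<lambda>K x. (SOME r. r \<in> K) \<odot>\<^bsub>M\<^esub> x) \<rparr>"

definition composition_series ::
  "('a, 'r) ring_scheme \<Rightarrow> ('a, 'b, 'm) module_scheme \<Rightarrow> nat \<Rightarrow> (nat \<Rightarrow> 'b set) \<Rightarrow> bool" where
  "composition_series R M l C \<longleftrightarrow>
     C 0 = {\<zero>\<^bsub>M\<^esub>} \<and> C l = carrier M \<and> (\<forall>i\<le>l. submodule (C i) R M) \<and>
     (\<forall>i<l. C i \<subset> C (Suc i) \<and> (\<nexists>S. submodule S R M \<and> C i \<subset> S \<and> S \<subset> C (Suc i)))"

definition finite_length :: "('a, 'r) ring_scheme \<Rightarrow> ('a, 'b, 'm) module_scheme \<Rightarrow> bool" where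
  "finite_length R M \<longleftrightarrow> (\<exists>l C. composition_series R M l C)"

definition decomposable :: "('a, 'r) ring_scheme \<Rightarrow> ('a, 'b, 'm) module_scheme \<Rightarrow> bool" where
  "decomposable R M \<longleftrightarrow>
     (\<exists>A B. submodule A R M \<and> submodule B R M \<and> A \<noteq> {\<zero>\<^bsub>M\<^esub>} \<and> B \<noteq> {\<zero>\<^bsub>M\<^esub>} \<and>
            A <+>\<^bsub>M\<^esub> B = carrier M \<and> A \<inter> B = {\<zero>\<^bsub>M\<^esub>})"

definition module_basis ::
  "('a, 'r) ring_scheme \<Rightarrow> ('a, 'b, 'm) module_scheme \<Rightarrow> 'b set \<Rightarrow> bool" where
  "module_basis R M B \<longleftrightarrow> B \<subseteq> carrier M \<and>
     (\<forall>x\<in>carrier M. \<exists>!c. c \<in> B \<rightarrow>\<^sub>E carrier R \<and> finite {b \<in> B. c b \<noteq> \<zero>\<^bsub>R\<^esub>} \<and>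
        x = (\<Oplus>\<^bsub>M\<^esub>b\<in>{b \<in> B. c b \<noteq> \<zero>\<^bsub>R\<^esub>}. c b \<odot>\<^bsub>M\<^esub> b))"

definition free_module :: "('a, 'r) ring_scheme \<Rightarrow> ('a, 'b, 'm) module_scheme \<Rightarrow> bool" where
  "free_module R M \<longleftrightarrow> (\<exists>B. module_basis R M B)"


section \<open>Depth, Cohen--Macaulay rings, systems of parameters\<close>

text \<open>
  The empty sequence is regular when \<open>R\<close> is nonzero, so the depth below is that of \<open>R\<close> as a
  module over itself.
\<close>

definition regular_sequence :: "('a, 'r) ring_scheme \<Rightarrow> 'a list \<Rightarrow> bool" where
  "regular_sequence R xs \<longleftrightarrow>
     set xs \<subseteq> carrier R \<and>
     (\<forall>i<length xs. let Q = quot_module R (Idl\<^bsub>R\<^esub> (set (take i xs))) in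
        \<forall>K\<in>carrier Q. (xs ! i) \<odot>\<^bsub>Q\<^esub> K = \<zero>\<^bsub>Q\<^esub> \<longrightarrow> K = \<zero>\<^bsub>Q\<^esub>) \<and>
     Idl\<^bsub>R\<^esub> (set xs) \<noteq> carrier R"

definition depth :: "('a, 'r) ring_scheme \<Rightarrow> enat" where
  "depth R = Sup {enat (length xs) | xs. set xs \<subseteq> max_ideal R \<and> regular_sequence R xs}"

text \<open>Meaningful for Noetherian local rings only.\<close>

definition cohen_macaulay :: "('a, 'r) ring_scheme \<Rightarrow> bool" where
  "cohen_macaulay R \<longleftrightarrow> depth R = krull_dim R"

text \<open>Injectivity: the \<open>a i\<close> enumerate a set of exactly \<open>d\<close> elements, \<open>d\<close> being the dimension.\<close>

definition system_of_parameters :: "('a, 'r) ring_scheme \<Rightarrow> nat \<Rightarrow> (nat \<Rightarrow> 'a) \<Rightarrow> bool" where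
  "system_of_parameters R d a \<longleftrightarrow>
     krull_dim R = enat d \<and> inj_on a {1..d} \<and> a ` {1..d} \<subseteq> max_ideal R \<and>
     finite_length R (quot_module R (Idl\<^bsub>R\<^esub> (a ` {1..d})))"

definition power_ideal :: "('a, 'r) ring_scheme \<Rightarrow> nat \<Rightarrow> (nat \<Rightarrow> 'a) \<Rightarrow> (nat \<Rightarrow> nat) \<Rightarrow> 'a set" where
  "power_ideal R d a n = Idl\<^bsub>R\<^esub> ((\<lambda>i. a i [^]\<^bsub>R\<^esub> n i) ` {1..d})"


section \<open>The constructions yield modules\<close>

lemma quot_module_simps [simp]:
  "carrier (quot_module R I) = carrier (R Quot I)"
  "zero (quot_module R I) = zero (R Quot I)"
  "add (quot_module R I) = add (R Quot I)"
  "smult (quot_module R I) r K = (I +>\<^bsub>R\<^esub> r) \<otimes>\<^bsub>R Quot I\<^esub> K"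
  by (simp_all add: quot_module_def ring.defs module.defs)

lemma quot_module_module:
  assumes "cring R" "ideal I R"
  shows "module R (quot_module R I)"
proof -
  interpret R: cring R by fact
  interpret I: ideal I R by fact
  interpret Q: cring "R Quot I" using I.quotient_is_cring[OF assms(1)] .
  interpret h: ring_hom_ring R "R Quot I" "(+>\<^bsub>R\<^esub>) I" by (rule I.rcos_ring_hom_ring)
  have ag: "abelian_group (quot_module R I)"
  proof (rule abelian_groupI, unfold quot_module_simps)
    fix x assume "x \<in> carrier (R Quot I)"
    then show "\<exists>y\<in>carrier (R Quot I). y \<oplus>\<^bsub>R Quot I\<^esub> x = \<zero>\<^bsub>R Quot I\<^esub>"
      using Q.l_neg Q.a_inv_closed by blast
  qed (simp_all add: Q.a_ac)
  show ?thesis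
    by (rule moduleI[OF assms(1) ag], unfold quot_module_simps)
      (simp_all add: Q.l_distr Q.r_distr Q.m_assoc)
qed

lemma hom_module_module:
  assumes "module R M" "module R N"
  shows "module R (hom_module R M N)" (is "module R ?H")
proof -
  interpret M: module R M by fact
  interpret N: module R N by fact
  have carrI: "f \<in> carrier ?H"
    if "f \<in> carrier M \<rightarrow>\<^sub>E carrier N"
      "\<And>x y. x \<in> carrier M \<Longrightarrow> y \<in> carrier M \<Longrightarrow> f (x \<oplus>\<^bsub>M\<^esub> y) = f x \<oplus>\<^bsub>N\<^esub> f y"
      "\<And>r x. r \<in> carrier R \<Longrightarrow> x \<in> carrier M \<Longrightarrow> f (r \<odot>\<^bsub>M\<^esub> x) = r \<odot>\<^bsub>N\<^esub> f x" for f
    using that by (simp add: hom_module_def PiE_iff)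
  have ext: "f \<in> extensional (carrier M)" if "f \<in> carrier ?H" for f
    using that by (simp add: hom_module_def PiE_iff)
  have cl: "f x \<in> carrier N" if "f \<in> carrier ?H" "x \<in> carrier M" for f x
    using that by (auto simp: hom_module_def)
  have lin: "f (x \<oplus>\<^bsub>M\<^esub> y) = f x \<oplus>\<^bsub>N\<^esub> f y"
    if "f \<in> carrier ?H" "x \<in> carrier M" "y \<in> carrier M" for f x y
    using that by (auto simp: hom_module_def)
  have lin': "f (r \<odot>\<^bsub>M\<^esub> x) = r \<odot>\<^bsub>N\<^esub> f x"
    if "f \<in> carrier ?H" "x \<in> carrier M" "r \<in> carrier R" for f x r
    using that by (auto simp: hom_module_def)
  have ops: "zero ?H = (\<lambda>x\<in>carrier M. \<zero>\<^bsub>N\<^esub>)"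
    "add ?H = (\<lambda>f g. \<lambda>x\<in>carrier M. f x \<oplus>\<^bsub>N\<^esub> g x)"
    "smult ?H = (\<lambda>r f. \<lambda>x\<in>carrier M. r \<odot>\<^bsub>N\<^esub> f x)"
    by (simp_all add: hom_module_def)
  have smult_cl: "r \<odot>\<^bsub>?H\<^esub> f \<in> carrier ?H" if "r \<in> carrier R" "f \<in> carrier ?H" for r f
    using that
    by (intro carrI)
      (simp_all add: ops cl[OF that(2)] lin[OF that(2)] lin'[OF that(2)]
        N.smult_r_distr N.smult_assoc1[symmetric] M.R.m_comm)
  have add_cl: "f \<oplus>\<^bsub>?H\<^esub> g \<in> carrier ?H" if "f \<in> carrier ?H" "g \<in> carrier ?H" for f g
    using that
    by (intro carrI)
      (simp_all add: ops cl[OF that(1)] lin[OF that(1)] lin'[OF that(1)]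
        cl[OF that(2)] lin[OF that(2)] lin'[OF that(2)] N.smult_r_distr N.M.a_ac)
  have zero_cl: "zero ?H \<in> carrier ?H"
    by (intro carrI) (simp_all add: ops)
  have ag: "abelian_group ?H"
  proof (rule abelian_groupI)
    fix f assume f: "f \<in> carrier ?H"
    show "\<zero>\<^bsub>?H\<^esub> \<oplus>\<^bsub>?H\<^esub> f = f"
      by (rule extensionalityI[OF _ ext[OF f]]) (simp_all add: ops f cl[OF f])
    have "(\<ominus>\<^bsub>R\<^esub> \<one>\<^bsub>R\<^esub>) \<odot>\<^bsub>?H\<^esub> f \<oplus>\<^bsub>?H\<^esub> f = \<zero>\<^bsub>?H\<^esub>"
      by (rule extensionalityI[of _ "carrier M"])
        (simp_all add: ops f cl[OF f] N.smult_l_minus N.M.l_neg)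
    with smult_cl[OF _ f] show "\<exists>g\<in>carrier ?H. g \<oplus>\<^bsub>?H\<^esub> f = \<zero>\<^bsub>?H\<^esub>"
      by (meson M.R.a_inv_closed M.R.one_closed)
  next
    fix f g assume fg: "f \<in> carrier ?H" "g \<in> carrier ?H"
    show "f \<oplus>\<^bsub>?H\<^esub> g = g \<oplus>\<^bsub>?H\<^esub> f"
      by (rule extensionalityI[of _ "carrier M"]) (simp_all add: ops fg[THEN cl] N.M.a_comm)
    fix h assume h: "h \<in> carrier ?H"
    show "f \<oplus>\<^bsub>?H\<^esub> g \<oplus>\<^bsub>?H\<^esub> h = f \<oplus>\<^bsub>?H\<^esub> (g \<oplus>\<^bsub>?H\<^esub> h)"
      by (rule extensionalityI[of _ "carrier M"]) (simp_all add: ops fg[THEN cl] h[THEN cl] N.M.a_assoc)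
  qed (fact add_cl zero_cl)+
  show ?thesis
  proof (rule moduleI[OF M.R.cring_axioms ag smult_cl])
    fix r s f assume a: "r \<in> carrier R" "s \<in> carrier R" "f \<in> carrier ?H"
    show "(r \<oplus>\<^bsub>R\<^esub> s) \<odot>\<^bsub>?H\<^esub> f = r \<odot>\<^bsub>?H\<^esub> f \<oplus>\<^bsub>?H\<^esub> s \<odot>\<^bsub>?H\<^esub> f"
      by (rule extensionalityI[of _ "carrier M"]) (simp_all add: ops a(1,2) a(3)[THEN cl] N.smult_l_distr)
    show "(r \<otimes>\<^bsub>R\<^esub> s) \<odot>\<^bsub>?H\<^esub> f = r \<odot>\<^bsub>?H\<^esub> (s \<odot>\<^bsub>?H\<^esub> f)"
      by (rule extensionalityI[of _ "carrier M"]) (simp_all add: ops a(1,2) a(3)[THEN cl] N.smult_assoc1)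
  next
    fix r f g assume a: "r \<in> carrier R" "f \<in> carrier ?H" "g \<in> carrier ?H"
    show "r \<odot>\<^bsub>?H\<^esub> (f \<oplus>\<^bsub>?H\<^esub> g) = r \<odot>\<^bsub>?H\<^esub> f \<oplus>\<^bsub>?H\<^esub> r \<odot>\<^bsub>?H\<^esub> g"
      by (rule extensionalityI[of _ "carrier M"]) (simp_all add: ops a(1) a(2,3)[THEN cl] N.smult_r_distr)
  next
    fix f assume f: "f \<in> carrier ?H"
    show "\<one>\<^bsub>R\<^esub> \<odot>\<^bsub>?H\<^esub> f = f"
      by (rule extensionalityI[OF _ ext[OF f]]) (simp_all add: ops f cl[OF f])
  qed
qed

lemma descend_simps [simp]:
  "carrier (descend M) = carrier M"
  "zero (descend M) = zero M"
  "add (descend M) = add M"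
  "smult (descend M) K x = (SOME r. r \<in> K) \<odot>\<^bsub>M\<^esub> x"
  by (simp_all add: descend_def)

lemma descend_smult:
  assumes M: "module R M" and I: "ideal I R"
    and ann: "\<And>r x. r \<in> I \<Longrightarrow> x \<in> carrier M \<Longrightarrow> r \<odot>\<^bsub>M\<^esub> x = \<zero>\<^bsub>M\<^esub>"
    and r: "r \<in> carrier R" and x: "x \<in> carrier M"
  shows "(I +>\<^bsub>R\<^esub> r) \<odot>\<^bsub>descend M\<^esub> x = r \<odot>\<^bsub>M\<^esub> x"
proof -
  interpret M: module R M by fact
  interpret I: ideal I R by fact
  define s where "s = (SOME s. s \<in> I +>\<^bsub>R\<^esub> r)"
  have "s \<in> I +>\<^bsub>R\<^esub> r"
    unfolding s_def by (rule someI, rule I.a_rcos_self[OF r])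
  then obtain h where h: "h \<in> I" "s = h \<oplus>\<^bsub>R\<^esub> r"
    by (auto simp: a_r_coset_def r_coset_def)
  then have "s \<odot>\<^bsub>M\<^esub> x = h \<odot>\<^bsub>M\<^esub> x \<oplus>\<^bsub>M\<^esub> r \<odot>\<^bsub>M\<^esub> x"
    using I.a_Hcarr r x by (simp add: M.smult_l_distr)
  then show ?thesis
    using h r x by (simp add: s_def[symmetric] ann)
qed

lemma descend_module:
  assumes M: "module R M" and I: "ideal I R"
    and ann: "\<And>r x. r \<in> I \<Longrightarrow> x \<in> carrier M \<Longrightarrow> r \<odot>\<^bsub>M\<^esub> x = \<zero>\<^bsub>M\<^esub>"
  shows "module (R Quot I) (descend M)"
proof -
  interpret M: module R M by fact
  interpret I: ideal I R by fact
  interpret Q: cring "R Quot I" using I.quotient_is_cring[OF M.R.cring_axioms] .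
  interpret h: ring_hom_ring R "R Quot I" "(+>\<^bsub>R\<^esub>) I" by (rule I.rcos_ring_hom_ring)
  have act: "(I +>\<^bsub>R\<^esub> r) \<odot>\<^bsub>descend M\<^esub> x = r \<odot>\<^bsub>M\<^esub> x"
    if "r \<in> carrier R" "x \<in> carrier M" for r x
    by (rule descend_smult[OF M I ann that])
  have rep: "\<exists>r\<in>carrier R. K = I +>\<^bsub>R\<^esub> r" if "K \<in> carrier (R Quot I)" for K
    using that unfolding FactRing_def A_RCOSETS_def' partial_object.simps by blast
  have ag: "abelian_group (descend M)"
  proof (rule abelian_groupI, unfold descend_simps)
    fix x assume "x \<in> carrier M"
    then show "\<exists>y\<in>carrier M. y \<oplus>\<^bsub>M\<^esub> x = \<zero>\<^bsub>M\<^esub>"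
      using M.M.l_neg M.M.a_inv_closed by blast
  qed (simp_all add: M.M.a_ac)
  show ?thesis
  proof (rule moduleI[OF Q.cring_axioms ag])
    fix K x assume "K \<in> carrier (R Quot I)" and x: "x \<in> carrier (descend M)"
    then obtain r where r: "r \<in> carrier R" "K = I +>\<^bsub>R\<^esub> r" using rep by blast
    show "K \<odot>\<^bsub>descend M\<^esub> x \<in> carrier (descend M)"
      using r x by (simp add: act del: descend_simps(4))
    fix y assume y: "y \<in> carrier (descend M)"
    show "K \<odot>\<^bsub>descend M\<^esub> (x \<oplus>\<^bsub>descend M\<^esub> y)
        = K \<odot>\<^bsub>descend M\<^esub> x \<oplus>\<^bsub>descend M\<^esub> K \<odot>\<^bsub>descend M\<^esub> y"
      using r x y by (simp add: act M.smult_r_distr del: descend_simps(4))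
  next
    fix K L x assume "K \<in> carrier (R Quot I)" "L \<in> carrier (R Quot I)"
      and x: "x \<in> carrier (descend M)"
    then obtain r s where r: "r \<in> carrier R" "K = I +>\<^bsub>R\<^esub> r" "s \<in> carrier R" "L = I +>\<^bsub>R\<^esub> s"
      using rep by meson
    have sum: "K \<oplus>\<^bsub>R Quot I\<^esub> L = I +>\<^bsub>R\<^esub> (r \<oplus>\<^bsub>R\<^esub> s)"
      and prod: "K \<otimes>\<^bsub>R Quot I\<^esub> L = I +>\<^bsub>R\<^esub> (r \<otimes>\<^bsub>R\<^esub> s)"
      using r by simp_all
    have x': "x \<in> carrier M" using x by simp
    note a1 = act[OF M.R.a_closed[OF r(1,3)] x'] and a2 = act[OF r(1) x'] and a3 = act[OF r(3) x']
      and a4 = act[OF M.R.m_closed[OF r(1,3)] x'] and a5 = act[OF r(1) M.smult_closed[OF r(3) x']]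
    show "(K \<oplus>\<^bsub>R Quot I\<^esub> L) \<odot>\<^bsub>descend M\<^esub> x
        = K \<odot>\<^bsub>descend M\<^esub> x \<oplus>\<^bsub>descend M\<^esub> L \<odot>\<^bsub>descend M\<^esub> x"
      unfolding sum unfolding r(2,4)
      unfolding a1 a2 a3 descend_simps(1-3) by (rule M.smult_l_distr[OF r(1,3) x'])
    show "(K \<otimes>\<^bsub>R Quot I\<^esub> L) \<odot>\<^bsub>descend M\<^esub> x = K \<odot>\<^bsub>descend M\<^esub> (L \<odot>\<^bsub>descend M\<^esub> x)"
      unfolding prod unfolding r(2,4)
      unfolding a4 a3 a5 by (rule M.smult_assoc1[OF r(1,3) x'])
  next
    fix x assume x: "x \<in> carrier (descend M)"
    then have "(I +>\<^bsub>R\<^esub> \<one>\<^bsub>R\<^esub>) \<odot>\<^bsub>descend M\<^esub> x = \<one>\<^bsub>R\<^esub> \<odot>\<^bsub>M\<^esub> x"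
      by (intro act M.R.one_closed) (simp only: descend_simps)
    also have "\<dots> = x" using x by (intro M.smult_one) (simp only: descend_simps)
    finally show "\<one>\<^bsub>R Quot I\<^esub> \<odot>\<^bsub>descend M\<^esub> x = x"
      unfolding FactRing_def monoid.simps .
  qed
qed

lemma hom_quot_annihilated:
  assumes R: "cring R" and I: "ideal I R" and N: "module R N"
    and r: "r \<in> I" and f: "f \<in> carrier (hom_module R (quot_module R I) N)"
  shows "r \<odot>\<^bsub>hom_module R (quot_module R I) N\<^esub> f = \<zero>\<^bsub>hom_module R (quot_module R I) N\<^esub>"
proof -
  interpret N: module R N by fact
  interpret I: ideal I R by fact
  interpret Q: cring "R Quot I" using I.quotient_is_cring[OF R] .
  interpret Q': module R "quot_module R I" by (rule quot_module_module[OF R I])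
  have rR: "r \<in> carrier R" using r by (rule I.a_Hcarr)
  have lin: "f (s \<odot>\<^bsub>quot_module R I\<^esub> K) = s \<odot>\<^bsub>N\<^esub> f K"
    if "s \<in> carrier R" "K \<in> carrier (quot_module R I)" for s K
    using that f by (auto simp: hom_module_def)
  have cl: "f K \<in> carrier N" if "K \<in> carrier (quot_module R I)" for K
    using that f by (auto simp: hom_module_def)
  have "r \<odot>\<^bsub>N\<^esub> f K = \<zero>\<^bsub>N\<^esub>" if K: "K \<in> carrier (quot_module R I)" for K
  proof -
    have "I +>\<^bsub>R\<^esub> r = \<zero>\<^bsub>R Quot I\<^esub>"
      using r I.a_rcos_const by (simp add: FactRing_def)
    then have "r \<odot>\<^bsub>quot_module R I\<^esub> K = \<zero>\<^bsub>R\<^esub> \<odot>\<^bsub>quot_module R I\<^esub> K"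
      using K Q'.smult_l_null[OF K] by simp
    then show ?thesis
      using lin[OF rR K] lin[OF N.R.zero_closed K] cl[OF K] by simp
  qed
  then show ?thesis by (auto simp: hom_module_def restrict_def fun_eq_iff)
qed

text \<open>The module in the theorem, for arbitrary ideals.\<close>

lemma descend_hom_quot_module:
  assumes R: "cring R" and I: "ideal I R" and J: "ideal J R"
  shows "module (R Quot I) (descend (hom_module R (quot_module R I) (quot_module R J)))"
  using assms by (intro descend_module hom_module_module quot_module_module hom_quot_annihilated)

end

theory Submission
  imports Defs
begin

text \<open>
  The two tuples of exponents differ in one place only. Fix an index i, write b for the i-th parameter
  and K for the ideal generated by some powers of the other parameters, and put I = K + (b^k),
  J = K + (b^(2k)). Evaluation at 1 identifies Hom(R/I, R/J) with (J : I)/J = (J : b^k)/J.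
  When k is so large that the ascending chain of the ideals K : b^n is constant from k on,
  J : b^k = (K : b^k) + (b^k) + J, and the sum of the first two ideals is direct modulo J
  (\<open>zero_divisor_hom_decomposable_not_free\<close>). If b is a zero divisor modulo K, the first summand is
  nonzero. The second is nonzero unless b is nilpotent modulo K, but then d - 1 parameters would
  already have the maximal ideal as the only prime over them, against Krull's height theorem
  (\<open>parameter_not_nilpotent_mod\<close>). The second summand is generated by the class of b^k, which is
  killed by an element outside I, namely by any z outside K with b z in K. In a free module over the
  local ring R/I a generator of a nonzero cyclic summand has a unit among its coordinates, and so is
  killed by no nonzero scalar (\<open>hom_quot_decomposable_not_free\<close>). So the module is not free.
  
  It remains to find i and K such that b is a zero divisor modulo K. Otherwise every parameter is a
  nonzerodivisor modulo every ideal generated by powers of the other ones. By Krull's intersection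
  theorem it is then a nonzerodivisor modulo the ideal of the preceding parameters alone, so that the
  parameters form a regular sequence and R is Cohen-Macaulay (\<open>cohen_macaulayI\<close>), because the depth
  never exceeds the dimension.
  
  The classical theorems of Krull are derived by computing with elements. A statement about the
  localization at a prime P becomes a statement up to factors outside P, and finiteness enters only
  through the ascending chain condition.
\<close>

section \<open>Ideals of commutative rings\<close>

lemma (in ring) ideal_closed:
  assumes "ideal I R"
  shows "x \<in> I \<Longrightarrow> x \<in> carrier R" "\<zero> \<in> I"
    "x \<in> I \<Longrightarrow> y \<in> I \<Longrightarrow> x \<oplus> y \<in> I" "x \<in> I \<Longrightarrow> \<ominus> x \<in> I"
    "x \<in> I \<Longrightarrow> y \<in> I \<Longrightarrow> x \<ominus> y \<in> I"
    "x \<in> I \<Longrightarrow> r \<in> carrier R \<Longrightarrow> r \<otimes> x \<in> I"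
    "x \<in> I \<Longrightarrow> r \<in> carrier R \<Longrightarrow> x \<otimes> r \<in> I"
proof -
  interpret I: ideal I R by fact
  show "x \<in> I \<Longrightarrow> x \<in> carrier R" "\<zero> \<in> I"
    "x \<in> I \<Longrightarrow> y \<in> I \<Longrightarrow> x \<oplus> y \<in> I" "x \<in> I \<Longrightarrow> \<ominus> x \<in> I"
    "x \<in> I \<Longrightarrow> y \<in> I \<Longrightarrow> x \<ominus> y \<in> I"
    "x \<in> I \<Longrightarrow> r \<in> carrier R \<Longrightarrow> r \<otimes> x \<in> I"
    "x \<in> I \<Longrightarrow> r \<in> carrier R \<Longrightarrow> x \<otimes> r \<in> I"
    by (auto simp: I.I_l_closed I.I_r_closed a_minus_def)
qed

context cring
begin

abbreviation adjoin :: "'a set \<Rightarrow> 'a \<Rightarrow> 'a set" where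
  "adjoin K b \<equiv> set_add R K (PIdl b)"

lemma idealI_cring:
  assumes "I \<subseteq> carrier R" "\<zero> \<in> I" "\<And>x y. x \<in> I \<Longrightarrow> y \<in> I \<Longrightarrow> x \<oplus> y \<in> I"
    "\<And>r x. r \<in> carrier R \<Longrightarrow> x \<in> I \<Longrightarrow> r \<otimes> x \<in> I"
  shows "ideal I R"
proof (rule idealI[OF ring_axioms])
  show "subgroup I (add_monoid R)"
  proof (rule add.subgroupI)
    show "\<ominus> x \<in> I" if "x \<in> I" for x
    proof -
      have "\<ominus> x = (\<ominus> \<one>) \<otimes> x" using that assms(1) by (simp add: l_minus subsetD)
      then show ?thesis using assms(4)[OF _ that, of "\<ominus> \<one>"] by simp
    qed
  qed (use assms(1-3) in auto)
  show "a \<otimes> x \<in> I" if "a \<in> I" "x \<in> carrier R" for a x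
    using that assms(1,4) m_comm by (metis subsetD)
qed (use assms(4) in auto)

lemma mem_adjoin_iff:
  "x \<in> adjoin K b \<longleftrightarrow> (\<exists>k\<in>K. \<exists>r\<in>carrier R. x = k \<oplus> r \<otimes> b)"
  by (auto simp: set_add_def' cgenideal_def)

lemma mem_adjoinI: "x = k \<oplus> r \<otimes> b \<Longrightarrow> k \<in> K \<Longrightarrow> r \<in> carrier R \<Longrightarrow> x \<in> adjoin K b"
  unfolding mem_adjoin_iff by blast

lemma ideal_adjoin: "ideal K R \<Longrightarrow> b \<in> carrier R \<Longrightarrow> ideal (adjoin K b) R"
  by (simp add: add_ideals cgenideal_ideal)

lemma subset_adjoin:
  assumes "ideal K R" "b \<in> carrier R"
  shows "K \<subseteq> adjoin K b" and "b \<in> adjoin K b"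
proof -
  note K = ideal_closed[OF assms(1)]
  show "K \<subseteq> adjoin K b"
  proof
    fix k assume "k \<in> K"
    then have "k = k \<oplus> \<zero> \<otimes> b" using K assms by simp
    then show "k \<in> adjoin K b" using \<open>k \<in> K\<close> by (auto simp: mem_adjoin_iff)
  qed
  have "b = \<zero> \<oplus> \<one> \<otimes> b" using assms by simp
  then show "b \<in> adjoin K b" using K(2) by (auto simp: mem_adjoin_iff)
qed

lemma adjoin_subset:
  assumes "ideal I R" "K \<subseteq> I" "b \<in> I"
  shows "adjoin K b \<subseteq> I"
  using ideal_closed(3,6)[OF assms(1)] assms(2,3) by (auto simp: mem_adjoin_iff subset_iff)

lemma genideal_insert:
  assumes "S \<subseteq> carrier R" "b \<in> carrier R"
  shows "Idl (insert b S) = adjoin (Idl S) b"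
proof (rule antisym)
  note I = genideal_ideal[OF assms(1)]
  show "Idl (insert b S) \<subseteq> adjoin (Idl S) b"
    using assms genideal_self[OF assms(1)] subset_adjoin[OF I assms(2)]
    by (intro genideal_minimal ideal_adjoin I) auto
  have ic: "insert b S \<subseteq> carrier R" using assms by auto
  show "adjoin (Idl S) b \<subseteq> Idl (insert b S)"
    using genideal_self[OF ic] genideal_ideal[OF ic] subset_Idl_subset[OF ic, of S]
    by (intro adjoin_subset) auto
qed

lemma ideal_colon:
  assumes "ideal K R" "b \<in> carrier R"
  shows "ideal {z \<in> carrier R. b \<otimes> z \<in> K} R"
  by (rule ideal.helper_max_prime[OF assms(1) cring_axioms assms(2)])

lemma primeideal_nat_pow:
  assumes "primeideal P R" "x \<in> carrier R" "x [^] (n::nat) \<in> P"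
  shows "x \<in> P"
proof -
  interpret P: primeideal P R by fact
  show ?thesis using assms(3)
  proof (induction n)
    case 0
    then show ?case using P.I_notcarr P.one_imp_carrier by auto
  next
    case (Suc n)
    then show ?case using P.I_prime[of "x [^] n" x] assms(2) by auto
  qed
qed

end

section \<open>Noetherian rings: Nakayama and prime avoidance\<close>

locale noetherian_cring = cring + noetherian_ring
begin

lemma ideal_seq_stabilizes:
  fixes F :: "nat \<Rightarrow> 'a set"
  assumes id: "\<And>n. ideal (F n) R" and mono: "\<And>n. F n \<subseteq> F (Suc n)"
  shows "\<exists>n0. \<forall>n\<ge>n0. F n = F n0"
proof -
  have le: "F m \<subseteq> F n" if "m \<le> n" for m n using lift_Suc_mono_le[of F] mono that by blast
  have "subset.chain {I. ideal I R} (range F)"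
    unfolding subset_chain_def using id le nat_le_linear by blast
  then have "\<Union>(range F) \<in> range F" by (intro ideal_chain_is_trivial) auto
  then obtain n0 where "\<Union>(range F) = F n0" by auto
  then show ?thesis using le by (intro exI[of _ n0]) blast
qed

text \<open>
  Noetherian induction reduces a claim about I to the case of a prime I: if u v lies in I but u and v
  do not, then I + (u), I + (v) and I : u are strictly larger, and the claim is known for them.
\<close>

lemma noetherian_induct [consumes 1, case_names step]:
  assumes "ideal I R"
    and step: "\<And>I. ideal I R \<Longrightarrow> (\<And>J. ideal J R \<Longrightarrow> I \<subset> J \<Longrightarrow> P J) \<Longrightarrow> P I"
  shows "P I"
proof -
  define r where "r = {(J, I). ideal I R \<and> ideal J R \<and> I \<subset> J}"
  have "wf r"
  proof (rule ccontr)
    assume "\<not> wf r"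
    then obtain F where F: "\<And>i. (F (Suc i), F i) \<in> r" unfolding wf_iff_no_infinite_down_chain by blast
    have "ideal (F i) R" for i using F[of i] by (simp add: r_def)
    moreover have "F i \<subseteq> F (Suc i)" for i using F[of i] by (simp add: r_def psubset_imp_subset)
    ultimately have "\<exists>n0. \<forall>n\<ge>n0. F n = F n0" by (rule ideal_seq_stabilizes)
    then obtain n0 where "\<forall>n\<ge>n0. F n = F n0" ..
    then have "F (Suc n0) = F n0" by (rule allE[of _ "Suc n0"]) simp
    then show False using F[of n0] by (auto simp: r_def)
  qed
  then show ?thesis using assms(1)
  proof (induction I)
    case (less I)
    then show ?case using step by (auto simp: r_def)
  qed
qed

text \<open>
  Nakayama's lemma over the localization at P, phrased without localizing and without generators:
  if M is contained in N + x M up to factors outside P, then it is contained in N up to such factors.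
  Iterating the hypothesis from z produces z_0, z_1, z_2, ... with z_i in N + (x z_{i+1}) locally, so
  that the local ideals N + (z_i) increase. Once they stop increasing, z_{i+1} = c z_i modulo N locally, hence
  (s - x c) z_i lies in N with s outside P, and z_i vanishes modulo N locally. This descends to z_0.
\<close>

lemma Nakayama_elements:
  assumes P: "primeideal P R" and N: "ideal N R" and x: "x \<in> P" and M: "M \<subseteq> carrier R"
    and ex: "\<And>z. z \<in> M \<Longrightarrow> \<exists>s\<in>carrier R - P. \<exists>w\<in>M. s \<otimes> z \<ominus> x \<otimes> w \<in> N"
    and z: "z \<in> M"
  shows "\<exists>t\<in>carrier R - P. t \<otimes> z \<in> N"
proof -
  interpret P: primeideal P R by fact
  note N' = ideal_closed[OF N] and P' = ideal_closed[OF P.is_ideal]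
  have xc [simp]: "x \<in> carrier R" using x P' by auto
  have oneP: "\<one> \<notin> P" using P.I_notcarr P.one_imp_carrier by blast
  have mulP: "s \<otimes> t \<in> carrier R - P" if "s \<in> carrier R - P" "t \<in> carrier R - P" for s t
    using that P.I_prime by auto
  obtain f g where fg: "\<And>z. z \<in> M \<Longrightarrow> g z \<in> carrier R - P \<and> f z \<in> M \<and> g z \<otimes> z \<ominus> x \<otimes> f z \<in> N"
    using ex by metis
  define Z where "Z n = (f ^^ n) z" for n
  have ZM: "Z n \<in> M" for n by (induction n) (auto simp: Z_def z fg)
  then have Zc [simp]: "Z n \<in> carrier R" for n using M by auto
  have ZS: "\<exists>s\<in>carrier R - P. s \<otimes> Z n \<ominus> x \<otimes> Z (Suc n) \<in> N" for n
    using fg[OF ZM[of n]] by (auto simp: Z_def)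
  \<comment> \<open>the contraction to R of the ideal that N and Z n generate in the localization at P\<close>
  define F where "F n = {w \<in> carrier R. \<exists>s\<in>carrier R - P. s \<otimes> w \<in> adjoin N (Z n)}" for n
  have NZ: "ideal (adjoin N (Z n)) R" for n by (simp add: ideal_adjoin N)
  have Fid: "ideal (F n) R" for n
  proof (rule idealI_cring)
    note C = ideal_closed[OF NZ[of n]]
    show "\<zero> \<in> F n" using oneP C(2) by (auto simp: F_def)
    show "u \<oplus> v \<in> F n" if "u \<in> F n" "v \<in> F n" for u v
    proof -
      from that obtain s t where st: "s \<in> carrier R - P" "t \<in> carrier R - P"
        and uv: "u \<in> carrier R" "v \<in> carrier R" "s \<otimes> u \<in> adjoin N (Z n)" "t \<otimes> v \<in> adjoin N (Z n)"
        by (auto simp: F_def)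
      have "(s \<otimes> t) \<otimes> (u \<oplus> v) = t \<otimes> (s \<otimes> u) \<oplus> s \<otimes> (t \<otimes> v)"
        using st uv(1,2) by (simp add: r_distr m_ac)
      also have "\<dots> \<in> adjoin N (Z n)" using st uv C by auto
      finally show ?thesis using mulP[OF st] uv by (auto simp: F_def)
    qed
    show "r \<otimes> u \<in> F n" if r: "r \<in> carrier R" and u: "u \<in> F n" for r u
    proof -
      from u obtain s where s: "s \<in> carrier R - P" "u \<in> carrier R" "s \<otimes> u \<in> adjoin N (Z n)"
        by (auto simp: F_def)
      then have "s \<otimes> (r \<otimes> u) = r \<otimes> (s \<otimes> u)" using r by (simp add: m_ac)
      also have "\<dots> \<in> adjoin N (Z n)" using C(6) s r by auto
      finally show ?thesis using s r by (auto simp: F_def)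
    qed
  qed (auto simp: F_def)
  have Fmono: "F n \<subseteq> F (Suc n)" for n
  proof
    fix w assume "w \<in> F n"
    then obtain s k r where w: "w \<in> carrier R" "s \<in> carrier R - P" "k \<in> N" "r \<in> carrier R"
        "s \<otimes> w = k \<oplus> r \<otimes> Z n" by (auto simp: F_def mem_adjoin_iff)
    obtain t where t: "t \<in> carrier R - P" "t \<otimes> Z n \<ominus> x \<otimes> Z (Suc n) \<in> N" using ZS by blast
    have [simp]: "k \<in> carrier R" "t \<in> carrier R" using w N' t by auto
    have "(t \<otimes> s) \<otimes> w = t \<otimes> (k \<oplus> r \<otimes> Z n)" using w t by (simp add: m_assoc)
    also have "\<dots> = (t \<otimes> k \<oplus> r \<otimes> (t \<otimes> Z n \<ominus> x \<otimes> Z (Suc n))) \<oplus> (r \<otimes> x) \<otimes> Z (Suc n)"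
      using w(4) Zc[of n] Zc[of "Suc n"] xc \<open>k \<in> carrier R\<close> \<open>t \<in> carrier R\<close> by algebra
    finally have "(t \<otimes> s) \<otimes> w \<in> adjoin N (Z (Suc n))"
      by (rule mem_adjoinI) (use w t N' xc in auto)
    then show "w \<in> F (Suc n)" using mulP[OF t(1) w(2)] w by (auto simp: F_def)
  qed
  obtain n where n: "F (Suc n) = F n"
    using ideal_seq_stabilizes[of F, OF Fid Fmono] by (metis le_SucI order_refl)
  have "Z (Suc n) \<in> F (Suc n)"
    using oneP subset_adjoin(2)[OF N Zc] by (auto simp: F_def intro!: bexI[of _ \<one>])
  then obtain s k r where w: "s \<in> carrier R - P" "k \<in> N" "r \<in> carrier R"
        "s \<otimes> Z (Suc n) = k \<oplus> r \<otimes> Z n" unfolding n by (auto simp: F_def mem_adjoin_iff)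
  have "\<exists>t\<in>carrier R - P. t \<otimes> Z n \<in> N"
  proof -
    obtain t where t: "t \<in> carrier R - P" "t \<otimes> Z n \<ominus> x \<otimes> Z (Suc n) \<in> N" using ZS by blast
    have [simp]: "k \<in> carrier R" "t \<in> carrier R" "s \<in> carrier R" using w N' t by auto
    have "(s \<otimes> t \<ominus> x \<otimes> r) \<otimes> Z n
        = s \<otimes> (t \<otimes> Z n \<ominus> x \<otimes> Z (Suc n)) \<oplus> x \<otimes> (s \<otimes> Z (Suc n)) \<ominus> x \<otimes> (r \<otimes> Z n)"
      using w(3) Zc[of n] Zc[of "Suc n"] xc \<open>s \<in> carrier R\<close> \<open>t \<in> carrier R\<close> by algebra
    also have "\<dots> = s \<otimes> (t \<otimes> Z n \<ominus> x \<otimes> Z (Suc n)) \<oplus> x \<otimes> k"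
      unfolding w(4) using w(3) Zc[of n] Zc[of "Suc n"] xc \<open>s \<in> carrier R\<close> \<open>t \<in> carrier R\<close> \<open>k \<in> carrier R\<close>
      by algebra
    also have "\<dots> \<in> N" using N' t w by auto
    finally have *: "(s \<otimes> t \<ominus> x \<otimes> r) \<otimes> Z n \<in> N" .
    have "s \<otimes> t \<ominus> x \<otimes> r \<notin> P"
    proof
      assume a: "s \<otimes> t \<ominus> x \<otimes> r \<in> P"
      have "s \<otimes> t = (s \<otimes> t \<ominus> x \<otimes> r) \<oplus> x \<otimes> r"
        using w(3) xc \<open>s \<in> carrier R\<close> \<open>t \<in> carrier R\<close> by algebra
      also have "\<dots> \<in> P" using P' a x w(3) by auto
      finally show False using mulP[OF w(1) t(1)] by auto
    qed
    then show ?thesis using * w(3) by (intro bexI[of _ "s \<otimes> t \<ominus> x \<otimes> r"]) auto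
  qed
  moreover have "\<exists>t\<in>carrier R - P. t \<otimes> Z i \<in> N" if Suc_i: "\<exists>t\<in>carrier R - P. t \<otimes> Z (Suc i) \<in> N" for i
  proof -
    obtain t where t: "t \<in> carrier R - P" "t \<otimes> Z (Suc i) \<in> N" using Suc_i by blast
    obtain s where s: "s \<in> carrier R - P" "s \<otimes> Z i \<ominus> x \<otimes> Z (Suc i) \<in> N" using ZS by blast
    have [simp]: "t \<in> carrier R" "s \<in> carrier R" using t s by auto
    have "(t \<otimes> s) \<otimes> Z i = t \<otimes> (s \<otimes> Z i \<ominus> x \<otimes> Z (Suc i)) \<oplus> x \<otimes> (t \<otimes> Z (Suc i))"
      using Zc[of i] Zc[of "Suc i"] xc \<open>s \<in> carrier R\<close> \<open>t \<in> carrier R\<close> by algebra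
    also have "\<dots> \<in> N" using N' s t by auto
    finally show ?thesis using mulP[OF t(1) s(1)] by blast
  qed
  ultimately have "\<exists>t\<in>carrier R - P. t \<otimes> Z 0 \<in> N"
    by (induction n) auto
  then show ?thesis by (simp add: Z_def)
qed

text \<open>
  Krull's lemma on prime ideals that avoid a multiplicative set. If neither u nor v is in I but u v
  is, then I + (u) and I + (v) cannot both meet S, for otherwise the product of an element of S in
  each would be in I and S; so Noetherian induction can pass to one of them.
\<close>

lemma exists_prime_disjoint:
  assumes "ideal I R" "I \<inter> S = {}" "S \<subseteq> carrier R" "\<one> \<in> S"
    and mult: "\<And>s t. s \<in> S \<Longrightarrow> t \<in> S \<Longrightarrow> s \<otimes> t \<in> S"
  shows "\<exists>P. primeideal P R \<and> I \<subseteq> P \<and> P \<inter> S = {}"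
  using assms(1,2)
proof (induction I rule: noetherian_induct)
  case (step I)
  note I = ideal_closed[OF step(1)]
  show ?case
  proof (cases "primeideal I R")
    case False
    have "carrier R \<noteq> I" using step(3) assms(4) by auto
    then obtain u v where uv: "u \<in> carrier R" "v \<in> carrier R" "u \<otimes> v \<in> I" "u \<notin> I" "v \<notin> I"
      using ideal.primeidealCD[OF step(1) cring_axioms False] by blast
    have "\<not> ((adjoin I u) \<inter> S \<noteq> {} \<and> (adjoin I v) \<inter> S \<noteq> {})"
    proof
      assume "(adjoin I u) \<inter> S \<noteq> {} \<and> (adjoin I v) \<inter> S \<noteq> {}"
      then obtain k r l q where k: "k \<in> I" "r \<in> carrier R" "k \<oplus> r \<otimes> u \<in> S"
        "l \<in> I" "q \<in> carrier R" "l \<oplus> q \<otimes> v \<in> S" by (auto simp: mem_adjoin_iff)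
      have [simp]: "k \<in> carrier R" "l \<in> carrier R" using k I by auto
      have "(k \<oplus> r \<otimes> u) \<otimes> (l \<oplus> q \<otimes> v) = (k \<otimes> (l \<oplus> q \<otimes> v)) \<oplus> ((r \<otimes> u) \<otimes> l \<oplus> (r \<otimes> q) \<otimes> (u \<otimes> v))"
        using k(2,5) uv(1,2) \<open>k \<in> carrier R\<close> \<open>l \<in> carrier R\<close> by algebra
      also have "\<dots> \<in> I" using I k uv by auto
      finally show False using step(3) mult[OF k(3,6)] by auto
    qed
    then obtain w where w: "w \<in> carrier R" "w \<notin> I" "(adjoin I w) \<inter> S = {}" using uv by blast
    then have "I \<subset> adjoin I w" using subset_adjoin[OF step(1) w(1)] by auto
    from step(2)[OF ideal_adjoin[OF step(1) w(1)] this w(3)] show ?thesis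
      using subset_adjoin(1)[OF step(1) w(1)] by blast
  qed (use step in auto)
qed

section \<open>Krull's height theorem\<close>

text \<open>
  If P is minimal over C, the localization of R/C at P is Artinian; this is its descending chain
  condition, stated for ideals of R and proved by Noetherian induction on C. If all D n meet the complement of P, they all become
  the unit ideal in the localization. Otherwise C lies in P; a prime C then equals P, and the chain
  ends at P. If C is not prime, take u v in C with u, v outside C. The chains
  D n + (u) and D n : u are locally stable by induction, and together they control D n, because
  the elements of D n that lie in C + (u) correspond to D n : u.
\<close>

lemma descending_chain_locally_stable:
  assumes P: "primeideal P R" and C: "ideal C R"
    and min: "\<And>P'. primeideal P' R \<Longrightarrow> C \<subseteq> P' \<Longrightarrow> P' \<subseteq> P \<Longrightarrow> P' = P"
    and D: "\<And>n. ideal (D n) R" "\<And>n. C \<subseteq> D n" "\<And>n. D (Suc n) \<subseteq> D n"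
  shows "\<exists>n0::nat. \<forall>n\<ge>n0. \<forall>y\<in>D n. \<exists>s\<in>carrier R - P. s \<otimes> y \<in> D (Suc n)"
  using C min D
proof (induction C arbitrary: D rule: noetherian_induct)
  case (step C D)
  interpret P: primeideal P R by fact
  note D' = ideal_closed[OF step(4)] and C' = ideal_closed[OF step(1)]
  have oneP: "\<one> \<notin> P" using P.I_notcarr P.one_imp_carrier by blast
  have desc: "D n \<subseteq> D m" if "m \<le> n" for m n
    using lift_Suc_antimono_le[of D] step(6) that by blast
  show ?case
  proof (cases "\<forall>n. \<not> D n \<subseteq> P")
    case True
    have "\<exists>s\<in>carrier R - P. s \<otimes> y \<in> D (Suc n)" if y: "y \<in> D n" for n y
    proof -
      obtain s where "s \<in> D (Suc n)" "s \<notin> P" using True by blast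
      then show ?thesis using y D' by (intro bexI[of _ s]) auto
    qed
    then show ?thesis by blast
  next
    case False
    then obtain n0 where n0: "D n0 \<subseteq> P" by blast
    with step(5)[of n0] have CP: "C \<subseteq> P" by auto
    show ?thesis
    proof (cases "primeideal C R")
      case True
      then have "C = P" using step(3) CP by blast
      then have "D n = P" if "n \<ge> n0" for n using desc[OF that] n0 step(5)[of n] by auto
      then have "\<exists>s\<in>carrier R - P. s \<otimes> y \<in> D (Suc n)" if "n \<ge> n0" "y \<in> D n" for n y
        using that oneP D' by (intro bexI[of _ \<one>]) auto
      then show ?thesis by blast
    next
      case False
      have "carrier R \<noteq> C" using CP oneP by auto
      then obtain u v where uv: "u \<in> carrier R" "v \<in> carrier R" "u \<otimes> v \<in> C" "u \<notin> C" "v \<notin> C"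
        using ideal.primeidealCD[OF step(1) cring_axioms False] by blast
      \<comment> \<open>the trace of K on the multiples of u\<close>
      define colon where "colon K = {z \<in> carrier R. u \<otimes> z \<in> K}" for K
      have "\<exists>n0. \<forall>n\<ge>n0. \<forall>y\<in>adjoin (D n) u. \<exists>s\<in>carrier R - P. s \<otimes> y \<in> adjoin (D (Suc n)) u"
      proof (rule step(2)[of "adjoin C u"])
        show "C \<subset> adjoin C u" using subset_adjoin[OF step(1) uv(1)] uv by auto
        then show "P' = P" if "primeideal P' R" "adjoin C u \<subseteq> P'" "P' \<subseteq> P" for P'
          using step(3) that by blast
      qed (use ideal_adjoin[OF step(1) uv(1)] ideal_adjoin[OF step(4) uv(1)] step(5,6)
          in \<open>auto simp: mem_adjoin_iff\<close>, blast+)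
      then obtain n1 where n1: "\<And>n y. n \<ge> n1 \<Longrightarrow> y \<in> adjoin (D n) u \<Longrightarrow>
        \<exists>s\<in>carrier R - P. s \<otimes> y \<in> adjoin (D (Suc n)) u" by blast
      have "\<exists>n0. \<forall>n\<ge>n0. \<forall>y\<in>colon (D n). \<exists>s\<in>carrier R - P. s \<otimes> y \<in> colon (D (Suc n))"
      proof (rule step(2)[of "colon C"])
        show "C \<subset> colon C" using uv C' by (auto simp: colon_def)
        then show "P' = P" if "primeideal P' R" "colon C \<subseteq> P'" "P' \<subseteq> P" for P'
          using step(3) that by blast
        show "ideal (colon C) R" "ideal (colon (D n)) R" for n
          unfolding colon_def by (intro ideal_colon step uv)+
      qed (use step(5,6) in \<open>auto simp: colon_def\<close>)
      then obtain n2 where n2: "\<And>n y. n \<ge> n2 \<Longrightarrow> y \<in> colon (D n) \<Longrightarrow>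
        \<exists>s\<in>carrier R - P. s \<otimes> y \<in> colon (D (Suc n))" by blast
      have "\<exists>s\<in>carrier R - P. s \<otimes> y \<in> D (Suc n)" if n: "n \<ge> max n1 n2" and y: "y \<in> D n" for n y
      proof -
        have yc: "y \<in> carrier R" using y D' by auto
        have "y \<in> adjoin (D n) u" using subset_adjoin(1)[OF step(4) uv(1)] y by auto
        then obtain s where s: "s \<in> carrier R - P" "s \<otimes> y \<in> adjoin (D (Suc n)) u" using n1[of n y] n by auto
        then obtain w r where wr: "w \<in> D (Suc n)" "r \<in> carrier R" "s \<otimes> y = w \<oplus> r \<otimes> u"
          by (auto simp: mem_adjoin_iff)
        have c: "w \<in> carrier R" "s \<in> carrier R" using wr D' s by auto
        have "u \<otimes> r = s \<otimes> y \<ominus> w" unfolding wr(3) using wr(2) c uv(1) by algebra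
        also have "\<dots> \<in> D n" by (rule D'(5)) (use D' y wr(1) step(6)[of n] c in auto)
        finally have "r \<in> colon (D n)" using wr by (auto simp: colon_def)
        then obtain t where t: "t \<in> carrier R - P" "u \<otimes> (t \<otimes> r) \<in> D (Suc n)"
          using n2[of n r] n by (auto simp: colon_def)
        have tc: "t \<in> carrier R" using t by auto
        have "(t \<otimes> s) \<otimes> y = t \<otimes> (w \<oplus> r \<otimes> u)" using tc c yc wr(3) by (simp add: m_assoc)
        also have "\<dots> = t \<otimes> w \<oplus> u \<otimes> (t \<otimes> r)" using tc c wr(2) uv(1) by algebra
        also have "\<dots> \<in> D (Suc n)" using D' t wr by auto
        finally show ?thesis using P.I_prime[OF tc c(2)] s t tc c by (intro bexI[of _ "t \<otimes> s"]) auto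
      qed
      then show ?thesis by blast
    qed
  qed
qed

text \<open>
  Krull's principal ideal theorem for the domain R/P0, in the form used to push an element down a
  chain of primes: a prime of height at least two is not minimal over a principal ideal. Suppose P
  were minimal over P0 + (x). For y in Q outside P0 let L n be the preimage of the ideal generated by
  y^n in the localization of R/P0 at Q. The chain L n + (x) is stable at P by the Artinian property,
  and x is not in Q, so L n = L (n+1) + x (L n) locally at P. Nakayama's lemma gives y^n in L (n+1)
  up to a factor outside P, and cancelling y^n in the domain R/P0 makes a product of elements outside
  Q lie in Q.
\<close>

lemma exists_prime_between:
  assumes P0: "primeideal P0 R" and Q: "primeideal Q R" and P: "primeideal P R"
    and sub: "P0 \<subset> Q" "Q \<subset> P" and x: "x \<in> P" "x \<notin> P0"
  shows "\<exists>P'. primeideal P' R \<and> P0 \<subset> P' \<and> P' \<subset> P \<and> x \<in> P'"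
proof (rule ccontr)
  assume contra: "\<not> ?thesis"
  interpret P0: primeideal P0 R by fact
  interpret Q: primeideal Q R by fact
  interpret P: primeideal P R by fact
  note P0' = ideal_closed[OF P0.is_ideal] and Q' = ideal_closed[OF Q.is_ideal]
  have min: "P' = P" if "primeideal P' R" "P0 \<subseteq> P'" "x \<in> P'" "P' \<subseteq> P" for P'
    using contra that x(2) by blast
  have xQ: "x \<notin> Q" using contra sub Q by blast
  have xc: "x \<in> carrier R" using x by auto
  obtain y where y: "y \<in> Q" "y \<notin> P0" using sub by blast
  have yc: "y \<in> carrier R" using y by auto
  have oneQ: "\<one> \<notin> Q" using Q.I_notcarr Q.one_imp_carrier by blast
  define K where "K n = adjoin P0 (y [^] n)" for n :: nat
  have K: "ideal (K n) R" for n using yc by (simp add: K_def ideal_adjoin P0.is_ideal)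
  note K' = ideal_closed[OF K]
  define L where "L n = {z \<in> carrier R. \<exists>s\<in>carrier R - Q. s \<otimes> z \<in> K n}" for n
  have Kmono: "K (Suc n) \<subseteq> K n" for n
  proof -
    have "y [^] Suc n \<in> K n"
      unfolding K_def by (rule mem_adjoinI[of _ \<zero> y]) (use yc P0' in \<open>auto simp: m_comm\<close>)
    then show ?thesis using K subset_adjoin(1)[OF P0.is_ideal, of "y [^] n"] yc
      unfolding K_def[of "Suc n"] by (intro adjoin_subset) (auto simp: K_def)
  qed
  have Lid: "ideal (L n) R" for n
  proof (rule idealI_cring)
    show "\<zero> \<in> L n" using oneQ K'(2) by (auto simp: L_def)
    show "u \<oplus> v \<in> L n" if "u \<in> L n" "v \<in> L n" for u v
    proof -
      from that obtain s t where st: "s \<in> carrier R" "s \<notin> Q" "t \<in> carrier R" "t \<notin> Q"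
        and uv: "u \<in> carrier R" "v \<in> carrier R" "s \<otimes> u \<in> K n" "t \<otimes> v \<in> K n"
        by (auto simp: L_def)
      have "(s \<otimes> t) \<otimes> (u \<oplus> v) = t \<otimes> (s \<otimes> u) \<oplus> s \<otimes> (t \<otimes> v)"
        using st uv(1,2) by (simp add: r_distr m_ac)
      also have "\<dots> \<in> K n" using st uv K' by auto
      finally show ?thesis using Q.I_prime[of s t] st uv by (auto simp: L_def intro!: bexI[of _ "s \<otimes> t"])
    qed
    show "r \<otimes> u \<in> L n" if r: "r \<in> carrier R" and u: "u \<in> L n" for r u
    proof -
      from u obtain s where s: "s \<in> carrier R - Q" "u \<in> carrier R" "s \<otimes> u \<in> K n"
        by (auto simp: L_def)
      then have "s \<otimes> (r \<otimes> u) = r \<otimes> (s \<otimes> u)" using r by (simp add: m_ac)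
      also have "\<dots> \<in> K n" using K' s r by auto
      finally show ?thesis using s r by (auto simp: L_def)
    qed
  qed (auto simp: L_def)
  note L' = ideal_closed[OF Lid]
  have Lmono: "L (Suc n) \<subseteq> L n" for n using Kmono by (auto simp: L_def)
  have KL: "K n \<subseteq> L n" for n
  proof
    fix z assume z: "z \<in> K n"
    then have "\<one> \<otimes> z \<in> K n" using K'(1)[OF z] by simp
    then show "z \<in> L n" using K'(1)[OF z] oneQ by (auto simp: L_def simp del: l_one)
  qed
  have P0L: "P0 \<subseteq> L n" for n
    using subset_adjoin(1)[OF P0.is_ideal, of "y [^] n"] yc KL[of n] by (auto simp: K_def)
  have "\<exists>n0. \<forall>n\<ge>n0. \<forall>y\<in>adjoin (L n) x. \<exists>s\<in>carrier R - P. s \<otimes> y \<in> adjoin (L (Suc n)) x"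
  proof (rule descending_chain_locally_stable[OF P, of "adjoin P0 x"])
    show "P' = P" if "primeideal P' R" "adjoin P0 x \<subseteq> P'" "P' \<subseteq> P" for P'
      using min that subset_adjoin[OF P0.is_ideal xc] by blast
    show "ideal (adjoin P0 x) R" "ideal (adjoin (L n) x) R" for n
      using ideal_adjoin xc P0.is_ideal Lid by auto
    show "adjoin P0 x \<subseteq> adjoin (L n) x" for n using P0L[of n] unfolding mem_adjoin_iff subset_iff by blast
    show "adjoin (L (Suc n)) x \<subseteq> adjoin (L n) x" for n using Lmono[of n] unfolding mem_adjoin_iff subset_iff by blast
  qed
  then obtain n where n: "\<And>z. z \<in> adjoin (L n) x \<Longrightarrow> \<exists>s\<in>carrier R - P. s \<otimes> z \<in> adjoin (L (Suc n)) x"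
    by blast
  have "\<exists>t\<in>carrier R - P. t \<otimes> y [^] n \<in> L (Suc n)"
  proof (rule Nakayama_elements[OF P Lid x(1)])
    show "L n \<subseteq> carrier R" by (auto simp: L_def)
    show "y [^] n \<in> L n" using KL[of n] subset_adjoin(2)[OF P0.is_ideal, of "y [^] n"] yc by (auto simp: K_def)
    fix z assume z: "z \<in> L n"
    then have zc: "z \<in> carrier R" by (auto simp: L_def)
    have "z \<in> adjoin (L n) x" using z subset_adjoin(1)[OF Lid xc] by blast
    then obtain s w r where s: "s \<in> carrier R - P" "w \<in> L (Suc n)" "r \<in> carrier R"
      "s \<otimes> z = w \<oplus> r \<otimes> x" using n[of z] unfolding mem_adjoin_iff by blast
    have c: "s \<in> carrier R" "w \<in> carrier R" using s by (auto simp: L_def)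
    have "x \<otimes> r = s \<otimes> z \<ominus> w" unfolding s(4) using s(3) c xc by algebra
    also have "\<dots> \<in> L n" by (rule L'(5)) (use L' s(1,2) Lmono[of n] z c in auto)
    finally obtain t where t: "t \<in> carrier R - Q" "t \<otimes> (x \<otimes> r) \<in> K n" by (auto simp: L_def)
    have "t \<otimes> x \<notin> Q" using Q.I_prime[of t x] t xc xQ by auto
    moreover have "(t \<otimes> x) \<otimes> r \<in> K n" using t xc s(3) by (simp add: m_assoc)
    ultimately have "r \<in> L n" using t s(3) xc by (auto simp: L_def)
    moreover have "s \<otimes> z \<ominus> x \<otimes> r = w" unfolding s(4) using s(3) c xc by algebra
    ultimately show "\<exists>s\<in>carrier R - P. \<exists>w\<in>L n. s \<otimes> z \<ominus> x \<otimes> w \<in> L (Suc n)"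
      using s by (intro bexI[of _ s] bexI[of _ r]) auto
  qed
  then obtain t s where t: "t \<in> carrier R - P" "s \<in> carrier R - Q" "s \<otimes> (t \<otimes> y [^] n) \<in> K (Suc n)"
    by (auto simp: L_def)
  then obtain p c where p: "p \<in> P0" "c \<in> carrier R" "s \<otimes> (t \<otimes> y [^] n) = p \<oplus> c \<otimes> (y [^] n \<otimes> y)"
    by (auto simp: K_def mem_adjoin_iff)
  have car: "t \<in> carrier R" "s \<in> carrier R" "p \<in> carrier R" "y [^] n \<in> carrier R" using t p yc by auto
  have "(y [^] n) \<otimes> (s \<otimes> t \<ominus> c \<otimes> y) = s \<otimes> (t \<otimes> y [^] n) \<ominus> c \<otimes> (y [^] n \<otimes> y)"
    using car yc p(2) by algebra
  also have "\<dots> = p" unfolding p(3) using car yc p(2) by algebra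
  finally have "(y [^] n) \<otimes> (s \<otimes> t \<ominus> c \<otimes> y) \<in> P0" using p by simp
  moreover have "y [^] n \<notin> P0" using primeideal_nat_pow[OF P0 yc] y by auto
  ultimately have "s \<otimes> t \<ominus> c \<otimes> y \<in> P0" using P0.I_prime[of "y [^] n" "s \<otimes> t \<ominus> c \<otimes> y"] car p yc by auto
  then have "s \<otimes> t \<ominus> c \<otimes> y \<in> Q" using sub by blast
  moreover have "s \<otimes> t = (s \<otimes> t \<ominus> c \<otimes> y) \<oplus> c \<otimes> y" using car yc p(2) by algebra
  moreover have "c \<otimes> y \<in> Q" using Q'(6) y(1) p(2) by blast
  ultimately have "s \<otimes> t \<in> Q" using Q'(3) by metis
  then show False using Q.I_prime[of s t] t sub by auto
qed

text \<open>
  A chain of l + 1 primes with largest member P, whose smallest member contains the set C. It is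
  built from the bottom, so that \<open>exists_prime_between\<close> can be applied at the top and then lower down.
\<close>

primrec prime_chain :: "'a set \<Rightarrow> nat \<Rightarrow> 'a set \<Rightarrow> bool" where
  "prime_chain C 0 P \<longleftrightarrow> primeideal P R \<and> C \<subseteq> P"
| "prime_chain C (Suc l) P \<longleftrightarrow> primeideal P R \<and> (\<exists>Q. prime_chain C l Q \<and> Q \<subset> P)"

lemma prime_chain_prime: "prime_chain C l P \<Longrightarrow> primeideal P R"
  by (cases l) auto

lemma prime_chain_subset: "prime_chain C l P \<Longrightarrow> C \<subseteq> P"
  by (induction l arbitrary: P) auto

text \<open>
  Forcing x into the bottom of a chain costs one step: the principal ideal theorem moves x from each
  member of the chain into the one below it.
\<close>

lemma prime_chain_insert:
  assumes "prime_chain C (Suc l) P" "x \<in> P"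
  shows "prime_chain (insert x C) l P"
  using assms
proof (induction l arbitrary: P)
  case 0
  then show ?case by auto
next
  case (Suc l)
  then obtain Q Q' where Q: "primeideal P R" "prime_chain C (Suc l) Q" "Q \<subset> P"
    and Q': "prime_chain C l Q'" "Q' \<subset> Q" by auto
  obtain P' where "prime_chain C (Suc l) P'" "P' \<subset> P" "x \<in> P'"
  proof (cases "x \<in> Q'")
    case False
    then obtain P' where "primeideal P' R" "Q' \<subset> P'" "P' \<subset> P" "x \<in> P'"
      using exists_prime_between[of Q' Q P x] Q Q' Suc.prems(2) prime_chain_prime by blast
    then show ?thesis using that[of P'] Q' by auto
  qed (use Q Q' that[of Q] in auto)
  then show ?case using Suc.IH Q(1) by auto
qed

text \<open>
  Krull's height theorem relative to C: if P is minimal over the ideal generated by C and F, then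
  chains of primes from C up to P have length at most the number of elements of F. Adding the elements
  of F to C one at a time shortens the chain by one each time.
\<close>

lemma height_le_card:
  assumes "prime_chain C l P" "finite F" "F \<subseteq> P"
    and "\<And>P'. primeideal P' R \<Longrightarrow> C \<union> F \<subseteq> P' \<Longrightarrow> P' \<subseteq> P \<Longrightarrow> P' = P"
  shows "l \<le> card F"
  using assms(2,1,3,4)
proof (induction F arbitrary: C l)
  case empty
  have False if l: "l = Suc k" for k
  proof -
    obtain Q where Q: "prime_chain C k Q" "Q \<subset> P" using empty(1) l by auto
    then have "Q = P" using empty(3)[of Q] prime_chain_prime prime_chain_subset by blast
    then show False using Q by blast
  qed
  then show ?case by (cases l) auto
next
  case (insert x F)
  show ?case
  proof (cases l)
    case (Suc k)
    then have "prime_chain (insert x C) k P" using insert.prems by (intro prime_chain_insert) auto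
    then have "k \<le> card F" using insert by (intro insert.IH[of "insert x C" k]) auto
    then show ?thesis using insert Suc by simp
  qed simp
qed

end

section \<open>Quotient modules, regular sequences and finite length\<close>

lemma (in module) submoduleI_smult:
  assumes "H \<subseteq> carrier M" "\<zero>\<^bsub>M\<^esub> \<in> H"
    and "\<And>x y. x \<in> H \<Longrightarrow> y \<in> H \<Longrightarrow> x \<oplus>\<^bsub>M\<^esub> y \<in> H"
    and smult: "\<And>r x. r \<in> carrier R \<Longrightarrow> x \<in> H \<Longrightarrow> r \<odot>\<^bsub>M\<^esub> x \<in> H"
  shows "submodule H R M"
proof (rule submoduleI)
  show "\<ominus>\<^bsub>M\<^esub> x \<in> H" if "x \<in> H" for x
    using smult[OF _ that, of "\<ominus> \<one>"] smult_l_minus[OF R.one_closed, of x] assms(1) that by auto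
qed (use assms in auto)

definition nonzerodivisor_mod :: "('a, 'r) ring_scheme \<Rightarrow> 'a set \<Rightarrow> 'a \<Rightarrow> bool" where
  "nonzerodivisor_mod R K b \<longleftrightarrow> (\<forall>z\<in>carrier R. b \<otimes>\<^bsub>R\<^esub> z \<in> K \<longrightarrow> z \<in> K)"

context cring begin

lemma quot_module_zero_iff:
  assumes "ideal I R" "x \<in> carrier R"
  shows "I +> x = \<zero>\<^bsub>quot_module R I\<^esub> \<longleftrightarrow> x \<in> I"
proof -
  interpret I: ideal I R by fact
  show ?thesis using assms I.a_rcos_const I.rcos_const_imp_mem by (auto simp: FactRing_def)
qed

lemma carrier_quot_module: "carrier (quot_module R I) = (+>) I ` carrier R"
  by (auto simp: FactRing_def A_RCOSETS_def')

lemma smult_quot_module: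
  assumes "ideal I R" "x \<in> carrier R" "r \<in> carrier R"
  shows "r \<odot>\<^bsub>quot_module R I\<^esub> (I +> x) = I +> (r \<otimes> x)"
  using ring_hom_mult[OF ideal.rcos_ring_hom[OF assms(1)], of r x] assms(2,3) by simp

lemma add_quot_module:
  assumes "ideal I R" "x \<in> carrier R" "y \<in> carrier R"
  shows "(I +> x) \<oplus>\<^bsub>quot_module R I\<^esub> (I +> y) = I +> (x \<oplus> y)"
  using ring_hom_add[OF ideal.rcos_ring_hom[OF assms(1)], of x y] assms(2,3) by simp

lemma cos_eq_iff:
  assumes "ideal I R" "x \<in> carrier R" "y \<in> carrier R"
  shows "I +> x = I +> y \<longleftrightarrow> x \<ominus> y \<in> I"
  using quotient_eq_iff_same_a_r_cos[OF assms] by simp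

lemma regular_sequence_iff:
  "regular_sequence R xs \<longleftrightarrow> set xs \<subseteq> carrier R \<and>
     (\<forall>i<length xs. nonzerodivisor_mod R (Idl (set (take i xs))) (xs ! i)) \<and>
     Idl (set xs) \<noteq> carrier R"
proof (cases "set xs \<subseteq> carrier R")
  case True
  have "(\<forall>K\<in>carrier (quot_module R I). (xs ! i) \<odot>\<^bsub>quot_module R I\<^esub> K = \<zero>\<^bsub>quot_module R I\<^esub>
           \<longrightarrow> K = \<zero>\<^bsub>quot_module R I\<^esub>) \<longleftrightarrow> nonzerodivisor_mod R I (xs ! i)"
    if i: "i < length xs" and I: "I = Idl (set (take i xs))" for i I
  proof -
    have id: "ideal I R" unfolding I using True set_take_subset by (intro genideal_ideal) fastforce
    have xi: "xs ! i \<in> carrier R" using i True by auto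
    have "xs ! i \<odot>\<^bsub>quot_module R I\<^esub> (I +> z) = \<zero>\<^bsub>quot_module R I\<^esub> \<longleftrightarrow> xs ! i \<otimes> z \<in> I"
      if "z \<in> carrier R" for z
      unfolding smult_quot_module[OF id that xi] by (rule quot_module_zero_iff[OF id]) (use xi that in simp)
    then show ?thesis unfolding carrier_quot_module nonzerodivisor_mod_def
      by (simp only: ball_simps quot_module_zero_iff[OF id] cong: ball_cong)
  qed
  then show ?thesis unfolding regular_sequence_def Let_def by simp
qed (auto simp: regular_sequence_def)

text \<open>
  If R/A has finite length, every prime P over A is maximal. In a composition series of R/A
  there is a first factor C (i+1)/C i in which some u lies outside P. For r outside P also r u lies
  outside P, so r u generates this simple factor, and u = c + t r u with c in P. Hence
  u (1 - t r) is in P, that is, r is invertible modulo P.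
\<close>

lemma prime_maximal_of_finite_length:
  assumes A: "ideal A R" and fl: "finite_length R (quot_module R A)"
    and P: "primeideal P R" "A \<subseteq> P"
  shows "maximalideal P R"
proof -
  let ?M = "quot_module R A"
  interpret P: primeideal P R by fact
  interpret M: module R ?M by (rule quot_module_module[OF cring_axioms A])
  note P' = ideal_closed[OF P.is_ideal]
  define W where "W = (+>) A ` P"
  have W_iff: "A +> x \<in> W \<longleftrightarrow> x \<in> P" if "x \<in> carrier R" for x
  proof
    assume "A +> x \<in> W"
    then obtain y where y: "y \<in> P" "A +> x = A +> y" by (auto simp: W_def)
    then have "x \<ominus> y \<in> P" using cos_eq_iff[OF A that, of y] P(2) by auto
    then have "(x \<ominus> y) \<oplus> y \<in> P" using P'(3) y by blast
    moreover have "(x \<ominus> y) \<oplus> y = x" using that P'(1)[OF y(1)] by algebra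
    ultimately show "x \<in> P" by simp
  qed (auto simp: W_def)
  obtain l C where C: "composition_series R ?M l C" using fl by (auto simp: finite_length_def)
  have C0: "C 0 = {\<zero>\<^bsub>?M\<^esub>}" and Cl: "C l = carrier ?M" and Csub: "\<And>i. i \<le> l \<Longrightarrow> submodule (C i) R ?M"
    and Cstep: "\<And>i. i < l \<Longrightarrow> C i \<subset> C (Suc i)"
      "\<And>i S. i < l \<Longrightarrow> submodule S R ?M \<Longrightarrow> C i \<subset> S \<Longrightarrow> \<not> S \<subset> C (Suc i)"
    using C unfolding composition_series_def by blast+
  have "A +> \<zero> = \<zero>\<^bsub>?M\<^esub>" using quot_module_zero_iff[OF A] ideal_closed(2)[OF A] by blast
  then have "C 0 \<subseteq> W" unfolding C0 using W_iff[of \<zero>] P'(2) by auto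
  moreover have "\<not> C l \<subseteq> W"
  proof -
    have "\<one> \<notin> P" using P.I_notcarr P.one_imp_carrier by blast
    moreover have "A +> \<one> \<in> C l" unfolding Cl carrier_quot_module by blast
    ultimately show ?thesis using W_iff[of \<one>] by auto
  qed
  ultimately obtain i where i: "i < l" "C i \<subseteq> W" "\<not> C (Suc i) \<subseteq> W"
    using dec_induct[of 0 l "\<lambda>i. C i \<subseteq> W"] by (meson zero_le)
  have Ci: "submodule (C i) R ?M" "submodule (C (Suc i)) R ?M" using Csub i(1) by auto
  note Cic = M.submoduleE[OF Ci(1)] and Csc = M.submoduleE[OF Ci(2)]
  obtain u where u: "u \<in> carrier R" "A +> u \<in> C (Suc i)" "u \<notin> P"
    using i(3) Csc(1) W_iff unfolding carrier_quot_module by blast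
  have inv: "\<exists>t\<in>carrier R. \<one> \<ominus> t \<otimes> r \<in> P" if r: "r \<in> carrier R" "r \<notin> P" for r
  proof -
    define v where "v = A +> (r \<otimes> u)"
    have ru: "r \<otimes> u \<notin> P" using P.I_prime[OF r(1) u(1)] r u by blast
    have v: "v \<in> carrier ?M" "v \<in> C (Suc i)" "v \<notin> W"
      unfolding v_def using r u ru W_iff[of "r \<otimes> u"] Csc(4)[OF r(1) u(2)] smult_quot_module[OF A u(1) r(1)]
      by (auto simp del: quot_module_simps simp: carrier_quot_module)
    \<comment> \<open>the submodule generated by C i and r u, which must be all of C (Suc i)\<close>
    define T where "T = {K \<oplus>\<^bsub>?M\<^esub> t \<odot>\<^bsub>?M\<^esub> v | K t. K \<in> C i \<and> t \<in> carrier R}"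
    have Cc: "K \<in> carrier ?M" if "K \<in> C i" for K using Cic(1) that by blast
    have zC: "\<zero>\<^bsub>?M\<^esub> \<in> C i" using Ci(1) by (metis submodule_def subgroup.one_closed monoid.simps(2))
    have "submodule T R ?M"
    proof (rule M.submoduleI_smult)
      show "T \<subseteq> carrier ?M" using Cc v by (auto simp: T_def simp del: quot_module_simps)
      have "\<zero>\<^bsub>?M\<^esub> = \<zero>\<^bsub>?M\<^esub> \<oplus>\<^bsub>?M\<^esub> \<zero> \<odot>\<^bsub>?M\<^esub> v" using v by (simp del: quot_module_simps)
      then show "\<zero>\<^bsub>?M\<^esub> \<in> T" using zC unfolding T_def by blast
      show "s \<odot>\<^bsub>?M\<^esub> x \<in> T" if s: "s \<in> carrier R" and x: "x \<in> T" for s x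
      proof -
        obtain K t where K: "K \<in> C i" "t \<in> carrier R" "x = K \<oplus>\<^bsub>?M\<^esub> t \<odot>\<^bsub>?M\<^esub> v" using x by (auto simp: T_def simp del: quot_module_simps)
        have "s \<odot>\<^bsub>?M\<^esub> x = s \<odot>\<^bsub>?M\<^esub> K \<oplus>\<^bsub>?M\<^esub> (s \<otimes> t) \<odot>\<^bsub>?M\<^esub> v"
          unfolding K(3) using s K Cc v by (simp del: quot_module_simps add: M.smult_r_distr M.smult_assoc1)
        then show ?thesis using Cic(4)[OF s K(1)] s K(2) unfolding T_def by blast
      qed
      show "x \<oplus>\<^bsub>?M\<^esub> y \<in> T" if xy: "x \<in> T" "y \<in> T" for x y
      proof -
        obtain K t where K: "K \<in> C i" "t \<in> carrier R" "x = K \<oplus>\<^bsub>?M\<^esub> t \<odot>\<^bsub>?M\<^esub> v" using xy by (auto simp: T_def simp del: quot_module_simps)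
        obtain L s where L: "L \<in> C i" "s \<in> carrier R" "y = L \<oplus>\<^bsub>?M\<^esub> s \<odot>\<^bsub>?M\<^esub> v" using xy by (auto simp: T_def simp del: quot_module_simps)
        have "x \<oplus>\<^bsub>?M\<^esub> y = (K \<oplus>\<^bsub>?M\<^esub> L) \<oplus>\<^bsub>?M\<^esub> (t \<oplus> s) \<odot>\<^bsub>?M\<^esub> v"
          unfolding K(3) L(3) using K L Cc v by (simp del: quot_module_simps add: M.smult_l_distr M.a_ac)
        then show ?thesis using Cic(5)[OF K(1) L(1)] K(2) L(2) unfolding T_def by blast
      qed
    qed
    moreover have "C i \<subset> T"
    proof -
      have "K \<in> T" if "K \<in> C i" for K
      proof -
        have "K = K \<oplus>\<^bsub>?M\<^esub> \<zero> \<odot>\<^bsub>?M\<^esub> v" using Cc that v by (simp del: quot_module_simps)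
        then show ?thesis using that unfolding T_def by blast
      qed
      moreover have "v = \<zero>\<^bsub>?M\<^esub> \<oplus>\<^bsub>?M\<^esub> \<one> \<odot>\<^bsub>?M\<^esub> v" using v by (simp del: quot_module_simps)
      then have "v \<in> T" using zC unfolding T_def by blast
      ultimately show ?thesis using v(3) i(2) by blast
    qed
    moreover have "T \<subseteq> C (Suc i)"
      using Cstep(1)[OF i(1)] Csc(4,5) v(2) by (auto simp: T_def simp del: quot_module_simps)
    ultimately have "T = C (Suc i)" using Cstep(2)[OF i(1)] by blast
    then have "A +> u \<in> T" using u by simp
    then obtain K t where K: "K \<in> C i" "t \<in> carrier R" "A +> u = K \<oplus>\<^bsub>?M\<^esub> t \<odot>\<^bsub>?M\<^esub> v"
      by (auto simp: T_def simp del: quot_module_simps)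
    then obtain p where p: "p \<in> P" "K = A +> p" using i(2) by (auto simp: W_def)
    have pc: "p \<in> carrier R" using p by auto
    have tru: "t \<odot>\<^bsub>?M\<^esub> v = A +> (t \<otimes> (r \<otimes> u))" unfolding v_def by (rule smult_quot_module[OF A]) (use r u K in auto)
    have "A +> u = A +> (p \<oplus> t \<otimes> (r \<otimes> u))"
      unfolding K(3) p(2) tru by (rule add_quot_module[OF A pc]) (use r u K in auto)
    then have *: "u \<ominus> (p \<oplus> t \<otimes> (r \<otimes> u)) \<in> P" using cos_eq_iff[OF A u(1)] pc K(2) r(1) u(1) P(2) by auto
    have "u \<otimes> (\<one> \<ominus> t \<otimes> r) = (u \<ominus> (p \<oplus> t \<otimes> (r \<otimes> u))) \<oplus> p" using u(1) pc K(2) r(1) by algebra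
    also have "\<dots> \<in> P" using * p P'(3) by blast
    finally have "\<one> \<ominus> t \<otimes> r \<in> P" using P.I_prime[OF u(1)] u(3) K(2) r(1) by auto
    then show ?thesis using K(2) by blast
  qed
  show ?thesis
  proof (rule maximalidealI)
    show "carrier R \<noteq> P" by (rule P.I_notcarr)
    fix J assume J: "ideal J R" "P \<subseteq> J" "J \<subseteq> carrier R"
    note J' = ideal_closed[OF J(1)]
    show "J = P \<or> J = carrier R"
    proof (rule disjCI)
      assume "J \<noteq> carrier R"
      show "J = P"
      proof (rule ccontr)
        assume "J \<noteq> P"
        then obtain r where r: "r \<in> J" "r \<notin> P" using J(2) by blast
        have rc: "r \<in> carrier R" using r J by blast
        obtain t where t: "t \<in> carrier R" "\<one> \<ominus> t \<otimes> r \<in> P" using inv[OF rc r(2)] by blast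
        have "\<one> = (\<one> \<ominus> t \<otimes> r) \<oplus> t \<otimes> r" using t(1) rc by algebra
        also have "\<dots> \<in> J" using J'(3,6) t r J(2) by blast
        finally show False using ideal.one_imp_carrier[OF J(1)] \<open>J \<noteq> carrier R\<close> by blast
      qed
    qed
  qed (rule P.is_ideal)
qed

end

section \<open>Local rings, depth and dimension\<close>

locale noetherian_local_ring = noetherian_cring +
  fixes \<mm>
  assumes max: "maximalideal \<mm> R" and max_unique: "maximalideal J R \<Longrightarrow> J = \<mm>"
begin

sublocale \<mm>: primeideal \<mm> R
  by (rule maximalideal_prime[OF max])

lemma max_ideal_eq: "max_ideal R = \<mm>"
  unfolding max_ideal_def using max max_unique by (rule the_equality)

lemma proper_ideal_subset: "ideal I R \<Longrightarrow> I \<noteq> carrier R \<Longrightarrow> I \<subseteq> \<mm>"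
proof (induction I rule: noetherian_induct)
  case (step I)
  show ?case
  proof (cases "maximalideal I R")
    case False
    then obtain J where J: "ideal J R" "I \<subseteq> J" "J \<noteq> I" "J \<noteq> carrier R"
      using maximalidealI[OF step(1)] step(3) by metis
    then show ?thesis using step(2)[of J] by blast
  qed (use max_unique in blast)
qed

lemma not_in_max_unit:
  assumes "r \<in> carrier R" "r \<notin> \<mm>"
  shows "\<exists>s\<in>carrier R. s \<otimes> r = \<one>"
proof -
  have "PIdl r = carrier R"
    using proper_ideal_subset[OF cgenideal_ideal[OF assms(1)]] cgenideal_self[OF assms(1)] assms(2) by blast
  then have "\<one> \<in> PIdl r" by simp
  then show ?thesis by (auto simp: cgenideal_def)
qed

lemma one_notin_max: "\<one> \<notin> \<mm>"
  using \<mm>.I_notcarr \<mm>.one_imp_carrier by blast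

lemma one_minus_notin_max:
  assumes "x \<in> \<mm>" shows "\<one> \<ominus> x \<notin> \<mm>"
proof
  assume "\<one> \<ominus> x \<in> \<mm>"
  then have "(\<one> \<ominus> x) \<oplus> x \<in> \<mm>" using assms by auto
  moreover have "(\<one> \<ominus> x) \<oplus> x = \<one>" using \<mm>.Icarr[OF assms] by algebra
  ultimately show False using one_notin_max by simp
qed

lemma mem_of_unit_mult:
  assumes "ideal C R" "t \<in> carrier R - \<mm>" "z \<in> carrier R" "t \<otimes> z \<in> C"
  shows "z \<in> C"
proof -
  obtain s where s: "s \<in> carrier R" "s \<otimes> t = \<one>" using not_in_max_unit assms(2) by blast
  have "z = (s \<otimes> t) \<otimes> z" using s(2) assms(3) by simp
  also have "\<dots> = s \<otimes> (t \<otimes> z)" using s(1) assms(2,3) m_assoc by blast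
  finally show ?thesis using ideal_closed(6)[OF assms(1,4) s(1)] by simp
qed

text \<open>
  Krull's intersection theorem for the powers of one element. Let M be the intersection of the ideals
  C + (b^n). Then M is contained in C + b M, so Nakayama's lemma applies: suppose
  C : b^e = C : b^(e+1), and write x in M as c + y b^(e+1) with c in C. Then w = y b^e is again in M:
  comparing with x = c' + y' b^(e+1+k) puts y - y' b^k into C : b^(e+1), hence y b^e into
  C + (b^(e+k)).
\<close>

lemma Krull_intersection_principal:
  assumes C: "ideal C R" and b: "b \<in> \<mm>" and z: "z \<in> carrier R"
    and all: "\<And>n::nat. z \<in> adjoin C (b [^] n)"
  shows "z \<in> C"
proof -
  note C' = ideal_closed[OF C]
  have bc: "b \<in> carrier R" and bp: "\<And>n::nat. b [^] n \<in> carrier R" using b by auto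
  define L where "L n = {y \<in> carrier R. b [^] (n::nat) \<otimes> y \<in> C}" for n
  have Lid: "ideal (L n) R" for n unfolding L_def by (rule ideal_colon[OF C bp])
  have Lmono: "L n \<subseteq> L (Suc n)" for n
  proof
    fix y assume y: "y \<in> L n"
    then have "b \<otimes> (b [^] n \<otimes> y) \<in> C" using C' bc by (auto simp: L_def)
    also have "b \<otimes> (b [^] n \<otimes> y) = b [^] Suc n \<otimes> y" using y bc bp by (simp add: L_def m_ac)
    finally show "y \<in> L (Suc n)" using y by (auto simp: L_def)
  qed
  obtain e where e: "L (Suc e) = L e"
    using ideal_seq_stabilizes[of L, OF Lid Lmono] by (metis le_SucI order_refl)
  define M where "M = {z \<in> carrier R. \<forall>n::nat. z \<in> adjoin C (b [^] n)}"
  have "\<exists>t\<in>carrier R - \<mm>. t \<otimes> z \<in> C"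
  proof (rule Nakayama_elements[OF \<mm>.primeideal C b])
    show "M \<subseteq> carrier R" by (auto simp: M_def)
    show "z \<in> M" using z all by (auto simp: M_def)
    fix x assume x: "x \<in> M"
    then have xc: "x \<in> carrier R" by (auto simp: M_def)
    have ex: "\<exists>c\<in>C. \<exists>y\<in>carrier R. x = c \<oplus> y \<otimes> b [^] n" for n :: nat
      using x by (auto simp: M_def mem_adjoin_iff)
    obtain c y where cy: "c \<in> C" "y \<in> carrier R" "x = c \<oplus> y \<otimes> b [^] Suc e" using ex by blast
    have cc: "c \<in> carrier R" using cy C' by auto
    define w where "w = b [^] e \<otimes> y"
    have wc: "w \<in> carrier R" using cy bp by (simp add: w_def)
    have "w \<in> adjoin C (b [^] k)" for k :: nat
    proof -
      obtain c' y' where cy': "c' \<in> C" "y' \<in> carrier R" "x = c' \<oplus> y' \<otimes> b [^] (Suc e + k)" using ex by blast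
      have cc': "c' \<in> carrier R" using cy' C' by auto
      have "b [^] Suc e \<otimes> (y \<ominus> b [^] k \<otimes> y') = y \<otimes> b [^] Suc e \<ominus> y' \<otimes> (b [^] Suc e \<otimes> b [^] k)"
        using cy(2) cy'(2) bp[of "Suc e"] bp[of k] by algebra
      also have "\<dots> = y \<otimes> b [^] Suc e \<ominus> y' \<otimes> b [^] (Suc e + k)"
        using bc nat_pow_mult[OF bc, of "Suc e" k] by (simp only:)
      also have "\<dots> = (x \<ominus> c) \<ominus> (x \<ominus> c')"
      proof -
        have "x \<ominus> c = y \<otimes> b [^] Suc e" unfolding cy(3) using cy(2) cc bp[of "Suc e"] by algebra
        moreover have "x \<ominus> c' = y' \<otimes> b [^] (Suc e + k)"
          unfolding cy'(3) using cy'(2) cc' bp[of "Suc e + k"] by algebra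
        ultimately show ?thesis by simp
      qed
      also have "\<dots> = c' \<ominus> c" using xc cc cc' by algebra
      also have "\<dots> \<in> C" using C'(5) cy cy' by blast
      finally have "y \<ominus> b [^] k \<otimes> y' \<in> L (Suc e)" using cy cy' bp by (auto simp: L_def simp del: nat_pow_Suc)
      then have "b [^] e \<otimes> (y \<ominus> b [^] k \<otimes> y') \<in> C" unfolding e by (simp add: L_def)
      moreover have "w = b [^] e \<otimes> (y \<ominus> b [^] k \<otimes> y') \<oplus> (b [^] e \<otimes> y') \<otimes> b [^] k"
        unfolding w_def using cy(2) cy'(2) bp[of e] bp[of k] by algebra
      ultimately show ?thesis using mem_adjoinI[of w _ "b [^] e \<otimes> y'"] cy'(2) bp[of e] by simp
    qed
    then have "w \<in> M" using wc by (auto simp: M_def)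
    moreover have "\<one> \<otimes> x \<ominus> b \<otimes> w \<in> C"
    proof -
      have "\<one> \<otimes> x \<ominus> b \<otimes> w = c" unfolding w_def cy(3) nat_pow_Suc using cy(2) cc bc bp[of e] by algebra
      then show ?thesis using cy by simp
    qed
    ultimately show "\<exists>s\<in>carrier R - \<mm>. \<exists>w\<in>M. s \<otimes> x \<ominus> b \<otimes> w \<in> C" using one_notin_max by blast
  qed
  then show ?thesis using mem_of_unit_mult[OF C _ z] by blast
qed

text \<open>
  If b z lies in C, then z lies in every C + (c^n), hence in C by the intersection theorem.
\<close>

lemma nonzerodivisor_mod_limit:
  assumes C: "ideal C R" and c: "c \<in> \<mm>" and b: "b \<in> carrier R"
    and nzd: "\<And>n::nat. 0 < n \<Longrightarrow> nonzerodivisor_mod R (adjoin C (c [^] n)) b"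
  shows "nonzerodivisor_mod R C b"
  unfolding nonzerodivisor_mod_def
proof (intro ballI impI)
  fix z assume z: "z \<in> carrier R" "b \<otimes> z \<in> C"
  show "z \<in> C"
  proof (rule Krull_intersection_principal[OF C c z(1)])
    fix n :: nat
    show "z \<in> adjoin C (c [^] n)"
    proof (cases "n = 0")
      case True
      have "z = \<zero> \<oplus> z \<otimes> c [^] n" using True z by simp
      then show ?thesis by (rule mem_adjoinI) (use z ideal_closed[OF C] in auto)
    next
      case False
      moreover have "C \<subseteq> adjoin C (c [^] n)" by (rule subset_adjoin[OF C]) (use c in auto)
      ultimately show ?thesis using nzd[of n] z by (auto simp: nonzerodivisor_mod_def)
    qed
  qed
qed

lemma nonzerodivisor_mod_limit_finite:
  fixes a :: "'i \<Rightarrow> 'a"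
  assumes "finite F" "a ` F \<subseteq> \<mm>" and S: "S \<subseteq> carrier R" and b: "b \<in> carrier R"
    and "\<And>n::'i \<Rightarrow> nat. (\<And>j. 0 < n j) \<Longrightarrow> nonzerodivisor_mod R (Idl (S \<union> (\<lambda>j. a j [^] n j) ` F)) b"
  shows "nonzerodivisor_mod R (Idl S) b"
  using assms(1,2,5)
proof (induction F)
  case empty
  then show ?case using empty(2)[of "\<lambda>_. 1"] by simp
next
  case (insert j F)
  have aF: "a ` F \<subseteq> \<mm>" "a j \<in> \<mm>" using insert.prems(1) by auto
  show ?case
  proof (rule insert.IH[OF aF(1)])
    fix n :: "'i \<Rightarrow> nat" assume n: "\<And>j. 0 < n j"
    let ?G = "S \<union> (\<lambda>j. a j [^] n j) ` F"
    have G: "?G \<subseteq> carrier R" using S aF(1) by auto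
    show "nonzerodivisor_mod R (Idl ?G) b"
    proof (rule nonzerodivisor_mod_limit[OF genideal_ideal[OF G] aF(2) b])
      fix e :: nat assume e: "0 < e"
      have "nonzerodivisor_mod R (Idl (S \<union> (\<lambda>i. a i [^] (n(j := e)) i) ` insert j F)) b"
        by (rule insert.prems(2)) (use n e in auto)
      also have "S \<union> (\<lambda>i. a i [^] (n(j := e)) i) ` insert j F = insert (a j [^] e) ?G"
        using insert.hyps by auto
      finally show "nonzerodivisor_mod R (adjoin (Idl ?G) (a j [^] e)) b"
        using genideal_insert[OF G] aF by auto
    qed
  qed
qed

lemma prime_chain_le_krull_dim:
  assumes "prime_chain {} l P" shows "enat l \<le> krull_dim R"
proof -
  have "\<exists>f :: nat \<Rightarrow> 'a set. f l = P \<and> (\<forall>i\<le>l. primeideal (f i) R) \<and> (\<forall>i<l. f i \<subset> f (Suc i))"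
    using assms
  proof (induction l arbitrary: P)
    case 0
    then show ?case by (intro exI[of _ "\<lambda>_. P"]) auto
  next
    case (Suc l)
    then obtain Q where Q: "primeideal P R" "prime_chain {} l Q" "Q \<subset> P" by auto
    obtain f where f: "f l = Q" "\<forall>i\<le>l. primeideal (f i) R" "\<forall>i<l. f i \<subset> f (Suc i)"
      using Suc.IH[OF Q(2)] by blast
    then show ?case using Q by (intro exI[of _ "f(Suc l := P)"]) (auto simp: less_Suc_eq le_Suc_eq)
  qed
  then show ?thesis unfolding krull_dim_def by (intro Sup_upper) blast
qed

text \<open>
  Since the dimension is finite and positive, the supremum defining it is attained; a chain that
  stops below the maximal ideal is extended by it.
\<close>

lemma prime_chain_of_krull_dim:
  assumes "krull_dim R = enat d" "0 < d"
  shows "\<exists>l\<ge>d. prime_chain {} l \<mm>"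
proof -
  let ?S = "{enat l | l. \<exists>P :: nat \<Rightarrow> 'a set. (\<forall>i\<le>l. primeideal (P i) R) \<and> (\<forall>i<l. P i \<subset> P (Suc i))}"
  have "\<exists>l P. d \<le> l \<and> (\<forall>i\<le>l. primeideal ((P :: nat \<Rightarrow> 'a set) i) R) \<and> (\<forall>i<l. P i \<subset> P (Suc i))"
  proof (rule ccontr)
    assume a: "\<not> ?thesis"
    have "Sup ?S \<le> enat (d - 1)"
    proof (rule Sup_least)
      fix x assume "x \<in> ?S"
      then obtain l where "x = enat l" "\<not> d \<le> l" using a by blast
      then show "x \<le> enat (d - 1)" by simp
    qed
    then show False using assms unfolding krull_dim_def by auto
  qed
  then obtain l and P :: "nat \<Rightarrow> 'a set" where lP: "d \<le> l" "\<And>i. i \<le> l \<Longrightarrow> primeideal (P i) R" "\<And>i. i < l \<Longrightarrow> P i \<subset> P (Suc i)"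
    by blast
  have "prime_chain {} i (P i)" if "i \<le> l" for i
    using that
  proof (induction i)
    case (Suc i)
    then show ?case using lP(2)[of "Suc i"] lP(3)[of i] by auto
  qed (use lP in auto)
  then have c: "prime_chain {} l (P l)" by simp
  have "P l \<subseteq> \<mm>" using proper_ideal_subset lP(2)[of l] unfolding primeideal_def primeideal_axioms_def by auto
  show ?thesis
  proof (cases "P l = \<mm>")
    case False
    then have "prime_chain {} (Suc l) \<mm>" using c \<open>P l \<subseteq> \<mm>\<close> \<mm>.primeideal by auto
    then show ?thesis using lP(1) le_SucI by blast
  qed (use c lP(1) in auto)
qed

text \<open>
  A nonzerodivisor x modulo an ideal lies in no minimal prime over that ideal. Concretely, the
  multiplicative set of all products x^n s with s outside P avoids the ideal, so there is a prime over
  the ideal inside P that does not contain x. Thus each member of the sequence contributes a step.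
\<close>

lemma prime_chain_of_nonzerodivisors:
  assumes xs: "set xs \<subseteq> carrier R"
    and nzd: "\<And>i. i < length xs \<Longrightarrow> nonzerodivisor_mod R (Idl (set (take i xs))) (xs ! i)"
    and P: "primeideal P R" "set xs \<subseteq> P"
  shows "prime_chain {} (length xs) P"
  using assms
proof (induction xs arbitrary: P rule: rev_induct)
  case (snoc x xs)
  interpret P: primeideal P R by (rule snoc)
  have xs: "set xs \<subseteq> carrier R" and x: "x \<in> carrier R" "x \<in> P" using snoc.prems by auto
  have id: "ideal (Idl (set xs)) R" by (rule genideal_ideal[OF xs])
  have sub: "Idl (set xs) \<subseteq> P" by (rule genideal_minimal[OF P.is_ideal]) (use snoc.prems in auto)
  have nz: "nonzerodivisor_mod R (Idl (set xs)) x" using snoc.prems(2)[of "length xs"] by simp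
  define S where "S = {x [^] n \<otimes> s | (n::nat) s. s \<in> carrier R - P}"
  have oneP: "\<one> \<notin> P" using P.I_notcarr P.one_imp_carrier by blast
  have SI: "x [^] n \<otimes> s \<in> S" if "s \<in> carrier R - P" for n :: nat and s using that by (auto simp: S_def)
  have disj: "x [^] n \<otimes> s \<notin> Idl (set xs)" if "s \<in> carrier R - P" for n :: nat and s
  proof (induction n)
    case 0
    then show ?case using that sub by auto
  next
    case (Suc n)
    have eq: "x [^] Suc n \<otimes> s = x \<otimes> (x [^] n \<otimes> s)" using x that by (simp add: m_ac)
    have "x [^] n \<otimes> s \<in> carrier R" using x that by auto
    then show ?case unfolding eq using nz Suc unfolding nonzerodivisor_mod_def by blast
  qed
  have "\<exists>P'. primeideal P' R \<and> Idl (set xs) \<subseteq> P' \<and> P' \<inter> S = {}"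
  proof (rule exists_prime_disjoint[OF id])
    show "Idl (set xs) \<inter> S = {}" using disj by (auto simp: S_def)
    show "S \<subseteq> carrier R" using x by (auto simp: S_def)
    show "\<one> \<in> S" using SI[of \<one> 0] oneP by simp
    fix u v assume "u \<in> S" "v \<in> S"
    then obtain n k :: nat and s t where uv: "u = x [^] n \<otimes> s" "v = x [^] k \<otimes> t" "s \<in> carrier R" "t \<in> carrier R"
      "s \<notin> P" "t \<notin> P" by (auto simp: S_def)
    have "u \<otimes> v = (x [^] n \<otimes> x [^] k) \<otimes> (s \<otimes> t)" unfolding uv(1,2) using uv(3,4) x by (simp add: m_ac)
    also have "\<dots> = x [^] (n + k) \<otimes> (s \<otimes> t)" using x by (simp add: nat_pow_mult)
    finally show "u \<otimes> v \<in> S" using SI[of "s \<otimes> t" "n + k"] P.I_prime[OF uv(3,4)] uv by auto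
  qed
  then obtain P' where P': "primeideal P' R" "Idl (set xs) \<subseteq> P'" "P' \<inter> S = {}" by blast
  interpret P': primeideal P' R by (rule P')
  have "P' \<subseteq> P"
  proof
    fix s assume s: "s \<in> P'"
    then have "s \<in> carrier R" by auto
    then show "s \<in> P" using SI[of s 0] P'(3) s by auto
  qed
  moreover have "x \<notin> P'" using SI[of \<one> 1] oneP P'(3) x by auto
  ultimately have "P' \<subset> P" using x by blast
  moreover have "prime_chain {} (length xs) P'"
  proof (rule snoc.IH[OF xs _ P'(1)])
    show "nonzerodivisor_mod R (Idl (set (take i xs))) (xs ! i)" if "i < length xs" for i
      using snoc.prems(2)[of i] that by (simp add: nth_append)
    show "set xs \<subseteq> P'" using P'(2) genideal_self[OF xs] by blast
  qed
  ultimately show ?case using snoc.prems(3) by auto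
qed simp

lemma depth_le_krull_dim: "depth R \<le> krull_dim R"
  unfolding depth_def
proof (rule Sup_least)
  fix x assume "x \<in> {enat (length xs) | xs. set xs \<subseteq> max_ideal R \<and> regular_sequence R xs}"
  then obtain xs where "x = enat (length xs)" "set xs \<subseteq> \<mm>" "regular_sequence R xs"
    by (auto simp: max_ideal_eq)
  then show "x \<le> krull_dim R"
    using prime_chain_of_nonzerodivisors[of xs \<mm>] \<mm>.primeideal prime_chain_le_krull_dim
    by (auto simp: regular_sequence_iff)
qed

text \<open>
  The regularity of a_1, ..., a_d only asks that each a_i be a nonzerodivisor modulo the preceding
  parameters. This follows from the hypothesis by letting the exponents of the later parameters tend
  to infinity, by Krull's intersection theorem. Hence the depth is at least d, and it never exceeds
  the dimension.
\<close>

lemma cohen_macaulayI: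
  assumes dim: "krull_dim R = enat d" and a: "a ` {1..d} \<subseteq> \<mm>"
    and nzd: "\<And>i n. i \<in> {1..d} \<Longrightarrow> (\<And>j. 0 < n j) \<Longrightarrow>
      nonzerodivisor_mod R (Idl ((\<lambda>j. a j [^] (n j :: nat)) ` ({1..d} - {i}))) (a i)"
  shows "cohen_macaulay R"
proof -
  define xs where "xs = map a [1..<Suc d]"
  have len: "length xs = d" by (simp add: xs_def)
  have set: "set xs = a ` {1..d}" by (auto simp: xs_def)
  have ac: "a j \<in> carrier R" if "j \<in> {1..d}" for j using a that \<mm>.Icarr by blast
  have "regular_sequence R xs"
    unfolding regular_sequence_iff set
  proof (intro conjI allI impI)
    show "a ` {1..d} \<subseteq> carrier R" using ac by auto
    show "Idl (a ` {1..d}) \<noteq> carrier R"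
      using genideal_minimal[OF \<mm>.is_ideal a] one_notin_max by auto
    fix i assume "i < length xs"
    then have i: "i < d" by (simp add: len)
    have nth: "xs ! i = a (Suc i)" using i by (simp add: xs_def del: upt_Suc)
    have tk: "set (take i xs) = a ` {1..i}" using i by (auto simp: xs_def take_map take_upt simp del: upt_Suc)
    show "nonzerodivisor_mod R (Idl (set (take i xs))) (xs ! i)"
      unfolding nth tk
    proof (rule nonzerodivisor_mod_limit_finite[of "{Suc (Suc i)..d}" a])
      fix n :: "nat \<Rightarrow> nat" assume n: "\<And>j. 0 < n j"
      \<comment> \<open>exponent 1 for the preceding parameters, arbitrary exponents for the later ones\<close>
      define n' where "n' j = (if j \<le> i then 1 else n j)" for j
      have "nonzerodivisor_mod R (Idl ((\<lambda>j. a j [^] n' j) ` ({1..d} - {Suc i}))) (a (Suc i))"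
        by (rule nzd) (use i n in \<open>auto simp: n'_def\<close>)
      also have "{1..d} - {Suc i} = {1..i} \<union> {Suc (Suc i)..d}" using i by auto
      also have "(\<lambda>j. a j [^] n' j) ` \<dots> = a ` {1..i} \<union> (\<lambda>j. a j [^] n j) ` {Suc (Suc i)..d}"
      proof -
        have "(\<lambda>j. a j [^] n' j) ` {1..i} = a ` {1..i}" 
          using ac i by (intro image_cong) (auto simp: n'_def)
        moreover have "(\<lambda>j. a j [^] n' j) ` {Suc (Suc i)..d} = (\<lambda>j. a j [^] n j) ` {Suc (Suc i)..d}"
          by (intro image_cong) (auto simp: n'_def)
        ultimately show ?thesis by (simp only: image_Un)
      qed
      finally show "nonzerodivisor_mod R (Idl (a ` {1..i} \<union> (\<lambda>j. a j [^] n j) ` {Suc (Suc i)..d})) (a (Suc i))" .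
    qed (use a ac i in auto)
  qed
  then have "enat (length xs) \<le> depth R"
    unfolding depth_def max_ideal_eq using a set by (intro Sup_upper CollectI exI[of _ xs]) simp
  then show ?thesis unfolding cohen_macaulay_def
    using depth_le_krull_dim dim len by auto
qed

text \<open>
  If a power of a_i were in the ideal generated by powers of the other parameters, then every prime
  containing those d - 1 parameters would contain all d of them, hence be maximal. The height theorem
  would bound the dimension by d - 1.
\<close>

lemma parameter_not_nilpotent_mod:
  assumes dim: "krull_dim R = enat d" and a: "a ` {1..d} \<subseteq> \<mm>"
    and fl: "finite_length R (quot_module R (Idl (a ` {1..d})))"
    and i: "i \<in> {1..d}" and n: "\<And>j. 0 < n j"
  shows "a i [^] (e::nat) \<notin> Idl ((\<lambda>j. a j [^] (n j :: nat)) ` ({1..d} - {i}))"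
proof
  have ac: "a j \<in> carrier R" if "j \<in> {1..d}" for j using a that \<mm>.Icarr by blast
  let ?K = "Idl ((\<lambda>j. a j [^] (n j :: nat)) ` ({1..d} - {i}))"
  assume nil: "a i [^] (e::nat) \<in> ?K"
  obtain l where l: "l \<ge> d" "prime_chain {} l \<mm>" using prime_chain_of_krull_dim[OF dim] i by auto
  have "l \<le> card (a ` ({1..d} - {i}))"
  proof (rule height_le_card[OF l(2)])
    show "a ` ({1..d} - {i}) \<subseteq> \<mm>" using a by auto
    fix P assume P: "primeideal P R" "{} \<union> a ` ({1..d} - {i}) \<subseteq> P" "P \<subseteq> \<mm>"
    interpret P: primeideal P R by (rule P)
    show "P = \<mm>"
    proof -
      have "(\<lambda>j. a j [^] n j) ` ({1..d} - {i}) \<subseteq> P"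
      proof (rule image_subsetI)
        fix j assume "j \<in> {1..d} - {i}"
        then have j: "j \<in> {1..d}" "j \<noteq> i" by auto
        then have "a j \<in> P" using P(2) by auto
        moreover obtain k where "n j = Suc k" using n[of j] by (cases "n j") auto
        ultimately show "a j [^] n j \<in> P" using P.I_l_closed[of "a j" "a j [^] k"] ac[OF j(1)] by simp
      qed
      then have "?K \<subseteq> P" by (rule genideal_minimal[OF P.is_ideal])
      then have "a i \<in> P" using primeideal_nat_pow[OF P(1) ac[OF i]] nil by blast
      then have "a ` {1..d} \<subseteq> P" using P(2) by auto
      then have "Idl (a ` {1..d}) \<subseteq> P" by (rule genideal_minimal[OF P.is_ideal])
      then have "maximalideal P R"
        using ac by (intro prime_maximal_of_finite_length[OF genideal_ideal fl P(1)]) auto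
      then show ?thesis by (rule max_unique)
    qed
  qed simp
  also have "card (a ` ({1..d} - {i})) \<le> card ({1..d} - {i})" by (rule card_image_le) simp
  also have "\<dots> < d" using i by simp
  finally show False using l(1) by simp
qed

end

section \<open>Homomorphisms between cyclic modules\<close>

lemma (in cring) ideal_quotient_ideal:
  assumes I: "ideal I R" and J: "ideal J R"
  shows "ideal {z \<in> carrier R. \<forall>x\<in>I. x \<otimes> z \<in> J} R"
proof (rule idealI_cring)
  note I' = ideal_closed[OF I] and J' = ideal_closed[OF J]
  fix s z assume s: "s \<in> carrier R" and z: "z \<in> {z \<in> carrier R. \<forall>x\<in>I. x \<otimes> z \<in> J}"
  have "x \<otimes> (s \<otimes> z) \<in> J" if x: "x \<in> I" for x
  proof -
    have "x \<otimes> (s \<otimes> z) = s \<otimes> (x \<otimes> z)" using I'(1)[OF x] s z by (intro m_lcomm) auto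
    then show ?thesis using J'(6) x s z by auto
  qed
  then show "s \<otimes> z \<in> {z \<in> carrier R. \<forall>x\<in>I. x \<otimes> z \<in> J}" using s z by auto
qed (use ideal_closed[OF I] ideal_closed[OF J] in \<open>auto simp: r_distr\<close>)

text \<open>
  A homomorphism R/I \<open>\<rightarrow>\<close> R/J is determined by the image of 1, which can be the class of any z with
  z I in J. So the Hom module is (J : I)/J; it is presented by a surjection from the ideal J : I with
  kernel J, which lets submodules and relations be handled by elements of R.
\<close>

lemma (in cring) hom_quot_presentation:
  fixes I J
  defines "H \<equiv> descend (hom_module R (quot_module R I) (quot_module R J))"
    and "M \<equiv> {z \<in> carrier R. \<forall>x\<in>I. x \<otimes> z \<in> J}"
  assumes I: "ideal I R" and J: "ideal J R"
  obtains \<phi> where "\<phi> ` M = carrier H"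
    "\<And>z w. z \<in> M \<Longrightarrow> w \<in> M \<Longrightarrow> \<phi> (z \<oplus> w) = \<phi> z \<oplus>\<^bsub>H\<^esub> \<phi> w"
    "\<And>s z. s \<in> carrier R \<Longrightarrow> z \<in> M \<Longrightarrow> \<phi> (s \<otimes> z) = (I +> s) \<odot>\<^bsub>H\<^esub> \<phi> z"
    "\<And>z. z \<in> M \<Longrightarrow> \<phi> z = \<zero>\<^bsub>H\<^esub> \<longleftrightarrow> z \<in> J"
proof
  let ?A = "quot_module R I" and ?B = "quot_module R J"
  let ?H0 = "hom_module R ?A ?B"
  \<comment> \<open>the homomorphism that sends the class of r to the class of z r, for a chosen representative r\<close>
  define \<phi> where "\<phi> z = (\<lambda>K\<in>carrier ?A. J +> (z \<otimes> (SOME r. r \<in> carrier R \<and> K = I +> r)))" for z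
  note I' = ideal_closed[OF I] and J' = ideal_closed[OF J]
  interpret A: module R ?A by (rule quot_module_module[OF cring_axioms I])
  interpret B: module R ?B by (rule quot_module_module[OF cring_axioms J])
  have cosA: "I +> r \<in> carrier ?A" and cosB: "J +> r \<in> carrier ?B" if "r \<in> carrier R" for r
    using that unfolding carrier_quot_module by blast+
  have Mc: "z \<in> carrier R" if "z \<in> M" for z using that by (simp add: M_def)
  have \<phi>: "\<phi> z (I +> r) = J +> (z \<otimes> r)" if z: "z \<in> M" and r: "r \<in> carrier R" for z r
  proof -
    define s where "s = (SOME s. s \<in> carrier R \<and> I +> r = I +> s)"
    have s: "s \<in> carrier R" "I +> r = I +> s"
      using someI[of "\<lambda>s. s \<in> carrier R \<and> I +> r = I +> s" r] r by (auto simp: s_def)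
    have "s \<ominus> r \<in> I" using cos_eq_iff[OF I s(1) r] s(2) by simp
    then have "(s \<ominus> r) \<otimes> z \<in> J" using z by (auto simp: M_def)
    also have "(s \<ominus> r) \<otimes> z = z \<otimes> s \<ominus> z \<otimes> r" using s(1) r Mc[OF z] by algebra
    finally have "J +> (z \<otimes> s) = J +> (z \<otimes> r)" using cos_eq_iff[OF J] s(1) r Mc[OF z] by auto
    then show ?thesis unfolding \<phi>_def restrict_apply if_P[OF cosA[OF r]] s_def[symmetric] .
  qed
  have ext: "f = g" if "f \<in> extensional (carrier ?A)" "g \<in> extensional (carrier ?A)"
    "\<And>r. r \<in> carrier R \<Longrightarrow> f (I +> r) = g (I +> r)" for f g :: "'a set \<Rightarrow> 'a set"
    by (rule extensionalityI[OF that(1,2)]) (use that(3) in \<open>auto simp: carrier_quot_module simp del: quot_module_simps\<close>)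
  have \<phi>ext: "\<phi> z \<in> extensional (carrier ?A)" for z unfolding \<phi>_def by simp
  have H: "carrier H = carrier ?H0" "zero H = zero ?H0" "add H = add ?H0" by (simp_all add: H_def)
  have \<phi>H: "\<phi> z \<in> carrier H" if z: "z \<in> M" for z
    unfolding H hom_module_def partial_object.simps
  proof (intro CollectI conjI ballI)
    show "\<phi> z \<in> carrier ?A \<rightarrow>\<^sub>E carrier ?B"
    proof (rule PiE_I)
      fix K assume "K \<in> carrier ?A"
      then obtain r where r: "r \<in> carrier R" "K = I +> r" unfolding carrier_quot_module by blast
      show "\<phi> z K \<in> carrier ?B" unfolding r(2) \<phi>[OF z r(1)] using cosB Mc[OF z] r(1) by blast
    qed (simp add: \<phi>_def del: quot_module_simps)
  next
    fix K L assume "K \<in> carrier ?A" "L \<in> carrier ?A"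
    then obtain r s where r: "r \<in> carrier R" "K = I +> r" "s \<in> carrier R" "L = I +> s"
      unfolding carrier_quot_module by blast
    have c: "r \<oplus> s \<in> carrier R" "z \<otimes> r \<in> carrier R" "z \<otimes> s \<in> carrier R" using r Mc[OF z] by auto
    show "\<phi> z (K \<oplus>\<^bsub>?A\<^esub> L) = \<phi> z K \<oplus>\<^bsub>?B\<^esub> \<phi> z L"
      unfolding r(2,4) add_quot_module[OF I r(1,3)] \<phi>[OF z r(1)] \<phi>[OF z r(3)] \<phi>[OF z c(1)]
        add_quot_module[OF J c(2,3)] using r Mc[OF z] by (simp add: r_distr)
  next
    fix s K assume s: "s \<in> carrier R" and "K \<in> carrier ?A"
    then obtain r where r: "r \<in> carrier R" "K = I +> r" unfolding carrier_quot_module by blast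
    have c: "s \<otimes> r \<in> carrier R" "z \<otimes> r \<in> carrier R" using r s Mc[OF z] by auto
    show "\<phi> z (s \<odot>\<^bsub>?A\<^esub> K) = s \<odot>\<^bsub>?B\<^esub> \<phi> z K"
      unfolding r(2) smult_quot_module[OF I r(1) s] \<phi>[OF z r(1)] \<phi>[OF z c(1)]
        smult_quot_module[OF J c(2) s] using r s Mc[OF z] by (simp add: m_lcomm)
  qed
  show "\<phi> ` M = carrier H"
  proof (intro antisym subsetI)
    fix f assume "f \<in> carrier H"
    then have f: "f \<in> carrier ?A \<rightarrow>\<^sub>E carrier ?B"
      and lin: "\<And>r K. r \<in> carrier R \<Longrightarrow> K \<in> carrier ?A \<Longrightarrow> f (r \<odot>\<^bsub>?A\<^esub> K) = r \<odot>\<^bsub>?B\<^esub> f K"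
      unfolding H hom_module_def by simp_all
    obtain z where z: "z \<in> carrier R" "f (I +> \<one>) = J +> z"
      using PiE_mem[OF f cosA[OF one_closed]] unfolding carrier_quot_module by blast
    have fz: "f (I +> r) = J +> (r \<otimes> z)" if r: "r \<in> carrier R" for r
    proof -
      have "f (I +> r) = f (r \<odot>\<^bsub>?A\<^esub> (I +> \<one>))" unfolding smult_quot_module[OF I one_closed r] using r by simp
      also have "\<dots> = J +> (r \<otimes> z)" unfolding lin[OF r cosA[OF one_closed]] z(2) by (rule smult_quot_module[OF J z(1) r])
      finally show ?thesis .
    qed
    have "z \<in> M"
      unfolding M_def
    proof (intro CollectI conjI ballI)
      fix x assume x: "x \<in> I"
      then have xc: "x \<in> carrier R" by (rule I'(1))
      have "I +> x = I +> \<zero>" using cos_eq_iff[OF I xc zero_closed] x xc by (simp add: a_minus_def)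
      then have "J +> (x \<otimes> z) = J +> (\<zero> \<otimes> z)" using fz[OF xc] fz[OF zero_closed] by simp
      then show "x \<otimes> z \<in> J" using cos_eq_iff[OF J, of "x \<otimes> z" "\<zero> \<otimes> z"] xc z(1) by (simp add: a_minus_def)
    qed (rule z)
    moreover have "f = \<phi> z"
      by (rule ext[OF _ \<phi>ext]) (use f fz \<phi>[OF \<open>z \<in> M\<close>] z m_comm in \<open>auto simp: PiE_iff simp del: quot_module_simps\<close>)
    ultimately show "f \<in> \<phi> ` M" by blast
  qed (use \<phi>H in blast)
  show "\<phi> (z \<oplus> w) = \<phi> z \<oplus>\<^bsub>H\<^esub> \<phi> w" if z: "z \<in> M" and w: "w \<in> M" for z w
  proof (rule ext[OF \<phi>ext])
    have zw: "z \<oplus> w \<in> M" using z w J' I' by (auto simp: M_def r_distr)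
    show "\<phi> z \<oplus>\<^bsub>H\<^esub> \<phi> w \<in> extensional (carrier ?A)" by (simp add: H hom_module_def)
    fix r assume r: "r \<in> carrier R"
    have "(\<phi> z \<oplus>\<^bsub>H\<^esub> \<phi> w) (I +> r) = \<phi> z (I +> r) \<oplus>\<^bsub>?B\<^esub> \<phi> w (I +> r)"
      unfolding H hom_module_def using cosA[OF r] by simp
    also have "\<dots> = J +> (z \<otimes> r \<oplus> w \<otimes> r)" unfolding \<phi>[OF z r] \<phi>[OF w r]
      by (rule add_quot_module[OF J]) (use r z w Mc in auto)
    finally show "\<phi> (z \<oplus> w) (I +> r) = (\<phi> z \<oplus>\<^bsub>H\<^esub> \<phi> w) (I +> r)"
      unfolding \<phi>[OF zw r] using r z w Mc by (simp add: l_distr)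
  qed
  show "\<phi> (s \<otimes> z) = (I +> s) \<odot>\<^bsub>H\<^esub> \<phi> z" if s: "s \<in> carrier R" and z: "z \<in> M" for s z
  proof -
    have "(I +> s) \<odot>\<^bsub>H\<^esub> \<phi> z = s \<odot>\<^bsub>?H0\<^esub> \<phi> z"
      unfolding H_def
      by (rule descend_smult[OF hom_module_module[OF A.module_axioms B.module_axioms] I _ s])
        (use \<phi>H[OF z] hom_quot_annihilated[OF cring_axioms I B.module_axioms] H in auto)
    moreover have "\<phi> (s \<otimes> z) = s \<odot>\<^bsub>?H0\<^esub> \<phi> z"
    proof (rule ext[OF \<phi>ext])
      have sz: "s \<otimes> z \<in> M" using ideal_closed(6)[OF ideal_quotient_ideal[OF I J]] z s unfolding M_def by blast
      show "s \<odot>\<^bsub>?H0\<^esub> \<phi> z \<in> extensional (carrier ?A)" by (simp add: hom_module_def)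
      fix r assume r: "r \<in> carrier R"
      have "(s \<odot>\<^bsub>?H0\<^esub> \<phi> z) (I +> r) = s \<odot>\<^bsub>?B\<^esub> \<phi> z (I +> r)"
        unfolding hom_module_def using cosA[OF r] by simp
      also have "\<dots> = J +> (s \<otimes> (z \<otimes> r))" unfolding \<phi>[OF z r]
        by (rule smult_quot_module[OF J]) (use r z s Mc in auto)
      finally show "\<phi> (s \<otimes> z) (I +> r) = (s \<odot>\<^bsub>?H0\<^esub> \<phi> z) (I +> r)"
        unfolding \<phi>[OF sz r] using r z s Mc by (simp add: m_assoc)
    qed
    ultimately show ?thesis by simp
  qed
  show "\<phi> z = \<zero>\<^bsub>H\<^esub> \<longleftrightarrow> z \<in> J" if z: "z \<in> M" for z
  proof
    assume "\<phi> z = \<zero>\<^bsub>H\<^esub>"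
    then have "\<phi> z (I +> \<one>) = \<zero>\<^bsub>?B\<^esub>"
      unfolding H hom_module_def using cosA[OF one_closed] by simp
    then show "z \<in> J" unfolding \<phi>[OF z one_closed] using quot_module_zero_iff[OF J Mc[OF z]] Mc[OF z] by simp
  next
    assume zJ: "z \<in> J"
    show "\<phi> z = \<zero>\<^bsub>H\<^esub>"
    proof (rule ext[OF \<phi>ext])
      show "\<zero>\<^bsub>H\<^esub> \<in> extensional (carrier ?A)" by (simp add: H hom_module_def)
      fix r assume r: "r \<in> carrier R"
      have "\<zero>\<^bsub>H\<^esub> (I +> r) = \<zero>\<^bsub>?B\<^esub>" unfolding H hom_module_def using cosA[OF r] by simp
      moreover have "z \<otimes> r \<in> J" by (rule J'(7)[OF zJ r])
      ultimately show "\<phi> z (I +> r) = \<zero>\<^bsub>H\<^esub> (I +> r)"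
        unfolding \<phi>[OF z r] using quot_module_zero_iff[OF J, of "z \<otimes> r"] Mc[OF z] r by auto
    qed
  qed
qed

text \<open>
  The hypotheses say that (J : I)/J is the direct sum of the nonzero images of X and of R b, and that
  some r outside I kills the class of b. In a free module over R/I this cannot happen. If all
  coordinates of the class of b in a basis were represented in the maximal ideal, then b would be in
  X + \<open>\<mm>\<close> b + J; projecting to the second summand, (1 - t) b would be in J for some t in \<open>\<mm>\<close>, and so
  would b. Hence some coordinate is a unit, and r annihilates it modulo I, so r is in I.
\<close>

lemma (in noetherian_local_ring) hom_quot_decomposable_not_free:
  fixes I J
  defines "H \<equiv> descend (hom_module R (quot_module R I) (quot_module R J))"
    and "M \<equiv> {z \<in> carrier R. \<forall>x\<in>I. x \<otimes> z \<in> J}"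
  assumes I: "ideal I R" and J: "ideal J R" and X: "ideal X R" and XM: "X \<subseteq> M" and bM: "b \<in> M"
    and span: "\<And>w. w \<in> M \<Longrightarrow> \<exists>x\<in>X. \<exists>y\<in>carrier R. w \<ominus> (x \<oplus> y \<otimes> b) \<in> J"
    and indep: "\<And>x y. x \<in> X \<Longrightarrow> y \<in> carrier R \<Longrightarrow> y \<otimes> b \<ominus> x \<in> J \<Longrightarrow> y \<otimes> b \<in> J"
    and XJ: "\<not> X \<subseteq> J" and bJ: "b \<notin> J"
    and r: "r \<in> carrier R" "r \<notin> I" "r \<otimes> b \<in> J"
  shows "decomposable (R Quot I) H" and "\<not> free_module (R Quot I) H"
proof -
  let ?S = "R Quot I"
  note J' = ideal_closed[OF J] and X' = ideal_closed[OF X]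
  interpret I: ideal I R by fact
  interpret S: cring ?S by (rule I.quotient_is_cring[OF cring_axioms])
  interpret H: module ?S H unfolding H_def by (rule descend_hom_quot_module[OF cring_axioms I J])
  obtain \<phi> where im: "\<phi> ` M = carrier H"
    and add: "\<And>z w. z \<in> M \<Longrightarrow> w \<in> M \<Longrightarrow> \<phi> (z \<oplus> w) = \<phi> z \<oplus>\<^bsub>H\<^esub> \<phi> w"
    and smult: "\<And>s z. s \<in> carrier R \<Longrightarrow> z \<in> M \<Longrightarrow> \<phi> (s \<otimes> z) = (I +> s) \<odot>\<^bsub>H\<^esub> \<phi> z"
    and zero: "\<And>z. z \<in> M \<Longrightarrow> \<phi> z = \<zero>\<^bsub>H\<^esub> \<longleftrightarrow> z \<in> J"
    using hom_quot_presentation[OF I J] unfolding H_def M_def by blast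
  have Mid: "ideal M R" unfolding M_def by (rule ideal_quotient_ideal[OF I J])
  note M' = ideal_closed[OF Mid]
  have \<phi>c: "\<phi> z \<in> carrier H" if "z \<in> M" for z using that im by blast
  have eqI: "\<phi> z = \<phi> w" if "z \<in> M" "w \<in> M" "z \<ominus> w \<in> J" for z w
  proof -
    have zw: "z \<ominus> w \<in> M" by (rule M'(5)[OF that(1,2)])
    have "z = (z \<ominus> w) \<oplus> w" using that M'(1)[OF that(1)] M'(1)[OF that(2)] by algebra
    then have "\<phi> z = \<phi> (z \<ominus> w) \<oplus>\<^bsub>H\<^esub> \<phi> w" using add[OF zw that(2)] by simp
    also have "\<phi> (z \<ominus> w) = \<zero>\<^bsub>H\<^esub>" using zero[OF zw] that by simp
    finally show ?thesis using \<phi>c[OF that(2)] by simp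
  qed
  have eqD: "z \<ominus> w \<in> J" if "z \<in> M" "w \<in> M" "\<phi> z = \<phi> w" for z w
  proof -
    have zw: "z \<ominus> w \<in> M" by (rule M'(5)[OF that(1,2)])
    have "z = (z \<ominus> w) \<oplus> w" using that M'(1)[OF that(1)] M'(1)[OF that(2)] by algebra
    then have "\<phi> w = \<phi> (z \<ominus> w) \<oplus>\<^bsub>H\<^esub> \<phi> w" using add[OF zw that(2)] that(3) by simp
    then have "\<phi> (z \<ominus> w) = \<zero>\<^bsub>H\<^esub>" using H.add.r_cancel_one \<phi>c[OF zw] \<phi>c[OF that(2)] by metis
    then show ?thesis using zero[OF zw] by simp
  qed
  have rep: "\<exists>s\<in>carrier R. K = I +> s" if "K \<in> carrier ?S" for K
    using that carrier_quot_module by auto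
  have cosS: "I +> s \<in> carrier ?S" if "s \<in> carrier R" for s
    using that carrier_quot_module[of I] by auto
  have bc: "b \<in> carrier R" using bM by (rule M'(1))
  have ybM: "y \<otimes> b \<in> M" if "y \<in> carrier R" for y by (rule M'(6)[OF bM that])
  have sub: "submodule (\<phi> ` Y) ?S H" if Y: "ideal Y R" "Y \<subseteq> M" for Y
  proof (rule H.submoduleI_smult)
    note Y' = ideal_closed[OF Y(1)]
    show "\<phi> ` Y \<subseteq> carrier H" using im Y by blast
    have "\<phi> \<zero> = \<zero>\<^bsub>H\<^esub>" using zero[OF M'(2)] J'(2) by simp
    then show "\<zero>\<^bsub>H\<^esub> \<in> \<phi> ` Y" using Y'(2) by (metis imageI)
    show "x \<oplus>\<^bsub>H\<^esub> y \<in> \<phi> ` Y" if "x \<in> \<phi> ` Y" "y \<in> \<phi> ` Y" for x y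
      using that add Y(2) Y'(3) by (smt (verit) imageE imageI subsetD)
    show "K \<odot>\<^bsub>H\<^esub> x \<in> \<phi> ` Y" if "K \<in> carrier ?S" "x \<in> \<phi> ` Y" for K x
      using rep[OF that(1)] that(2) smult Y(2) Y'(6) by (smt (verit) imageE imageI subsetD)
  qed
  show "decomposable ?S H"
    unfolding decomposable_def
  proof (intro exI conjI)
    have Pb: "PIdl b \<subseteq> M" using cgenideal_minimal[OF Mid bM] .
    show "submodule (\<phi> ` X) ?S H" by (rule sub[OF X XM])
    show "submodule (\<phi> ` (PIdl b)) ?S H" by (rule sub[OF cgenideal_ideal[OF bc] Pb])
    show "\<phi> ` X \<noteq> {\<zero>\<^bsub>H\<^esub>}" using XJ XM zero by blast
    show "\<phi> ` (PIdl b) \<noteq> {\<zero>\<^bsub>H\<^esub>}" using cgenideal_self[OF bc] bJ bM zero by blast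
    show "\<phi> ` X <+>\<^bsub>H\<^esub> \<phi> ` (PIdl b) = carrier H"
    proof (intro antisym subsetI)
      fix f assume "f \<in> \<phi> ` X <+>\<^bsub>H\<^esub> \<phi> ` (PIdl b)"
      then show "f \<in> carrier H" using XM Pb \<phi>c by (auto simp: set_add_def')
    next
      fix f assume "f \<in> carrier H"
      then obtain w where w: "w \<in> M" "f = \<phi> w" using im by blast
      then obtain x y where xy: "x \<in> X" "y \<in> carrier R" "w \<ominus> (x \<oplus> y \<otimes> b) \<in> J" using span by blast
      have "x \<oplus> y \<otimes> b \<in> M" by (rule M'(3)) (use xy XM ybM in auto)
      then have "f = \<phi> (x \<oplus> y \<otimes> b)" unfolding w(2) by (intro eqI w(1) xy(3))
      also have "\<dots> = \<phi> x \<oplus>\<^bsub>H\<^esub> \<phi> (y \<otimes> b)" using add xy XM ybM by blast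
      finally show "f \<in> \<phi> ` X <+>\<^bsub>H\<^esub> \<phi> ` (PIdl b)" using xy by (auto simp: set_add_def' cgenideal_def)
    qed
    show "\<phi> ` X \<inter> \<phi> ` (PIdl b) = {\<zero>\<^bsub>H\<^esub>}"
    proof (intro antisym subsetI)
      fix f assume "f \<in> \<phi> ` X \<inter> \<phi> ` (PIdl b)"
      then obtain x y where xy: "x \<in> X" "f = \<phi> x" "y \<in> carrier R" "f = \<phi> (y \<otimes> b)"
        by (auto simp: cgenideal_def)
      then have "y \<otimes> b \<ominus> x \<in> J" using eqD[of "y \<otimes> b" x] ybM XM by auto
      then have "\<phi> (y \<otimes> b) = \<zero>\<^bsub>H\<^esub>" using indep[OF xy(1,3)] zero[OF ybM[OF xy(3)]] by simp
      then show "f \<in> {\<zero>\<^bsub>H\<^esub>}" using xy(4) by simp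
    next
      fix f assume "f \<in> {\<zero>\<^bsub>H\<^esub>}"
      moreover have "\<phi> \<zero> = \<zero>\<^bsub>H\<^esub>" using zero[OF M'(2)] J'(2) by simp
      ultimately show "f \<in> \<phi> ` X \<inter> \<phi> ` (PIdl b)"
        using X'(2) ideal_closed(2)[OF cgenideal_ideal[OF bc]] by (metis IntI imageI singletonD)
    qed
  qed
  show "\<not> free_module ?S H"
  proof
    assume "free_module ?S H"
    then obtain B where mb: "module_basis ?S H B" unfolding free_module_def ..
    have B: "B \<subseteq> carrier H" using mb unfolding module_basis_def by (rule conjunct1)
    have basis: "\<exists>!c. c \<in> B \<rightarrow>\<^sub>E carrier ?S \<and> finite {b \<in> B. c b \<noteq> \<zero>\<^bsub>?S\<^esub>} \<and>
        x = (\<Oplus>\<^bsub>H\<^esub>b\<in>{b \<in> B. c b \<noteq> \<zero>\<^bsub>?S\<^esub>}. c b \<odot>\<^bsub>H\<^esub> b)" if "x \<in> carrier H" for x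
      using mb[unfolded module_basis_def, THEN conjunct2] that by (rule bspec)
    define supp where "supp c = {b \<in> B. c b \<noteq> \<zero>\<^bsub>?S\<^esub>}" for c
    obtain c where c: "c \<in> B \<rightarrow>\<^sub>E carrier ?S" "finite (supp c)" "\<phi> b = (\<Oplus>\<^bsub>H\<^esub>e\<in>supp c. c e \<odot>\<^bsub>H\<^esub> e)"
      using ex1_implies_ex[OF basis[OF \<phi>c[OF bM]]] unfolding supp_def by (elim exE conjE)
    have cc: "c e \<in> carrier ?S" if "e \<in> B" for e using c(1) that by blast
    have "\<exists>e\<in>B. \<exists>u\<in>carrier R - \<mm>. c e = I +> u"
    proof (rule ccontr)
      assume contra: "\<not> ?thesis"
      \<comment> \<open>the submodule of H that corresponds to X + \<mm> b; it contains \<mm> H\<close>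
      define T where "T = {\<phi> (x \<oplus> t \<otimes> b) | x t. x \<in> X \<and> t \<in> \<mm>}"
      have xtM: "x \<oplus> t \<otimes> b \<in> M" if "x \<in> X" "t \<in> \<mm>" for x t
        by (rule M'(3)) (use that XM ybM \<mm>.Icarr in auto)
      have Tadd: "f \<oplus>\<^bsub>H\<^esub> g \<in> T" if fg: "f \<in> T" "g \<in> T" for f g
      proof -
        obtain x t where x: "x \<in> X" "t \<in> \<mm>" "f = \<phi> (x \<oplus> t \<otimes> b)" using fg by (auto simp: T_def)
        obtain y s where y: "y \<in> X" "s \<in> \<mm>" "g = \<phi> (y \<oplus> s \<otimes> b)" using fg by (auto simp: T_def)
        have "f \<oplus>\<^bsub>H\<^esub> g = \<phi> ((x \<oplus> t \<otimes> b) \<oplus> (y \<oplus> s \<otimes> b))"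
          unfolding x(3) y(3) by (rule add[symmetric]) (use x y xtM in auto)
        also have "(x \<oplus> t \<otimes> b) \<oplus> (y \<oplus> s \<otimes> b) = (x \<oplus> y) \<oplus> (t \<oplus> s) \<otimes> b"
          using X'(1)[OF x(1)] X'(1)[OF y(1)] \<mm>.Icarr[OF x(2)] \<mm>.Icarr[OF y(2)] bc by algebra
        finally show ?thesis using X'(3)[OF x(1) y(1)] \<mm>.a_closed[OF x(2) y(2)] unfolding T_def by blast
      qed
      have Tz: "\<zero>\<^bsub>H\<^esub> \<in> T"
      proof -
        have "\<phi> (\<zero> \<oplus> \<zero> \<otimes> b) = \<zero>\<^bsub>H\<^esub>" using zero[of "\<zero> \<oplus> \<zero> \<otimes> b"] xtM[of \<zero> \<zero>] bc J' X' by simp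
        then show ?thesis using X'(2) \<mm>.zero_closed unfolding T_def by (metis (mono_tags, lifting) mem_Collect_eq)
      qed
      have Tsm: "c e \<odot>\<^bsub>H\<^esub> e \<in> T" if e: "e \<in> B" for e
      proof -
        obtain w where w: "w \<in> M" "e = \<phi> w" using e B im by blast
        obtain x y where xy: "x \<in> X" "y \<in> carrier R" "w \<ominus> (x \<oplus> y \<otimes> b) \<in> J" using span[OF w(1)] by blast
        have xyM: "x \<oplus> y \<otimes> b \<in> M" by (rule M'(3)) (use xy XM ybM in auto)
        have e2: "e = \<phi> (x \<oplus> y \<otimes> b)" unfolding w(2) by (rule eqI[OF w(1) xyM xy(3)])
        obtain t where t: "t \<in> carrier R" "c e = I +> t" using rep[OF cc[OF e]] by blast
        then have tm: "t \<in> \<mm>" using contra e by blast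
        have "c e \<odot>\<^bsub>H\<^esub> e = \<phi> (t \<otimes> (x \<oplus> y \<otimes> b))" unfolding t(2) unfolding e2 using smult[OF t(1) xyM] by simp
        also have "t \<otimes> (x \<oplus> y \<otimes> b) = t \<otimes> x \<oplus> (t \<otimes> y) \<otimes> b"
          using X'(1)[OF xy(1)] xy(2) t(1) bc by algebra
        finally show ?thesis using X'(6)[OF xy(1) t(1)] \<mm>.I_r_closed[OF tm xy(2)] unfolding T_def by blast
      qed
      have sum: "(\<Oplus>\<^bsub>H\<^esub>e\<in>F. c e \<odot>\<^bsub>H\<^esub> e) \<in> T" if "finite F" "F \<subseteq> B" for F
        using that
      proof (induction F)
        case (insert e F)
        have "(\<Oplus>\<^bsub>H\<^esub>e\<in>insert e F. c e \<odot>\<^bsub>H\<^esub> e) = c e \<odot>\<^bsub>H\<^esub> e \<oplus>\<^bsub>H\<^esub> (\<Oplus>\<^bsub>H\<^esub>e\<in>F. c e \<odot>\<^bsub>H\<^esub> e)"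
          using insert.hyps insert.prems B cc by (intro H.finsum_insert) auto
        then show ?case using Tadd Tsm insert by auto
      qed (simp add: Tz)
      have "\<phi> b \<in> T" unfolding c(3) by (rule sum) (use c(2) in \<open>auto simp: supp_def\<close>)
      then obtain x t where x: "x \<in> X" "t \<in> \<mm>" "\<phi> b = \<phi> (x \<oplus> t \<otimes> b)" by (auto simp: T_def)
      have tc: "t \<in> carrier R" "x \<in> carrier R" using x X' by auto
      have "b \<ominus> (x \<oplus> t \<otimes> b) \<in> J" by (rule eqD[OF bM xtM[OF x(1,2)] x(3)])
      also have "b \<ominus> (x \<oplus> t \<otimes> b) = (\<one> \<ominus> t) \<otimes> b \<ominus> x" using tc bc by algebra
      finally have "(\<one> \<ominus> t) \<otimes> b \<in> J" using indep[OF x(1), of "\<one> \<ominus> t"] tc by auto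
      then have "b \<in> J" using mem_of_unit_mult[OF J _ bc, of "\<one> \<ominus> t"] one_minus_notin_max[OF x(2)] tc by auto
      then show False using bJ by simp
    qed
    then obtain e u where e: "e \<in> B" "u \<in> carrier R" "u \<notin> \<mm>" "c e = I +> u" by blast
    let ?r = "I +> r"
    have rS: "?r \<in> carrier ?S" by (rule cosS[OF r(1)])
    \<comment> \<open>the coordinates of the product of r with the class of b, which is zero\<close>
    define c' where "c' = (\<lambda>b\<in>B. ?r \<otimes>\<^bsub>?S\<^esub> c b)"
    have c'E: "c' \<in> B \<rightarrow>\<^sub>E carrier ?S" using cc rS by (auto simp: c'_def)
    have supp': "supp c' \<subseteq> supp c" using rS by (auto simp: supp_def c'_def)
    have "(\<Oplus>\<^bsub>H\<^esub>e\<in>supp c'. c' e \<odot>\<^bsub>H\<^esub> e) = (\<Oplus>\<^bsub>H\<^esub>e\<in>supp c. c' e \<odot>\<^bsub>H\<^esub> e)"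
    proof (rule H.add.finprod_mono_neutral_cong_left[OF c(2) supp'])
      show "c' i \<odot>\<^bsub>H\<^esub> i = \<zero>\<^bsub>H\<^esub>" if "i \<in> supp c - supp c'" for i
        using that B by (auto simp: supp_def)
    qed (use c'E B in \<open>auto simp: supp_def PiE_iff\<close>)
    also have "\<dots> = (\<Oplus>\<^bsub>H\<^esub>e\<in>supp c. ?r \<odot>\<^bsub>H\<^esub> (c e \<odot>\<^bsub>H\<^esub> e))"
      by (rule H.finsum_cong') (use B cc rS in \<open>auto simp: supp_def c'_def H.smult_assoc1\<close>)
    also have "\<dots> = ?r \<odot>\<^bsub>H\<^esub> \<phi> b"
      unfolding c(3) by (rule H.finsum_smult_ldistr[OF c(2) rS, symmetric]) (use B cc in \<open>auto simp: supp_def\<close>)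
    also have "\<dots> = \<zero>\<^bsub>H\<^esub>" using smult[OF r(1) bM] zero[OF ybM[OF r(1)]] r(3) by simp
    finally have sum': "\<zero>\<^bsub>H\<^esub> = (\<Oplus>\<^bsub>H\<^esub>e\<in>supp c'. c' e \<odot>\<^bsub>H\<^esub> e)" by simp
    define Q where "Q c \<longleftrightarrow> c \<in> B \<rightarrow>\<^sub>E carrier ?S \<and> finite (supp c) \<and>
        \<zero>\<^bsub>H\<^esub> = (\<Oplus>\<^bsub>H\<^esub>e\<in>supp c. c e \<odot>\<^bsub>H\<^esub> e)" for c
    define c0 where "c0 = (\<lambda>b\<in>B. \<zero>\<^bsub>?S\<^esub>)"
    have s0: "supp c0 = {}" by (auto simp: supp_def c0_def)
    have "c0 \<in> B \<rightarrow>\<^sub>E carrier ?S" by (auto simp: c0_def)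
    moreover have "\<zero>\<^bsub>H\<^esub> = (\<Oplus>\<^bsub>H\<^esub>e\<in>supp c0. c0 e \<odot>\<^bsub>H\<^esub> e)" unfolding s0 by simp
    ultimately have "Q c0" using s0 by (simp add: Q_def)
    moreover have "Q c'" using c'E sum' finite_subset[OF supp' c(2)] by (simp only: Q_def)
    moreover have "\<exists>!c. Q c" using basis[OF H.M.zero_closed] unfolding Q_def supp_def .
    ultimately have "c' = c0" by blast
    then have "?r \<otimes>\<^bsub>?S\<^esub> (I +> u) = \<zero>\<^bsub>?S\<^esub>" using e by (metis c'_def c0_def restrict_apply')
    then have "I +> (r \<otimes> u) = \<zero>\<^bsub>?S\<^esub>" using ring_hom_mult[OF I.rcos_ring_hom r(1) e(2)] by simp
    then have "r \<otimes> u \<in> I" using quot_module_zero_iff[OF I, of "r \<otimes> u"] r(1) e(2) by simp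
    then have "r \<in> I" using mem_of_unit_mult[OF I _ r(1), of u] e r(1) by (simp add: m_comm)
    then show False using r(2) by simp
  qed
qed

section \<open>Varying the exponent of one parameter\<close>

text \<open>
  Choose k so large that K : b^n is the same ideal X for all n \<open>\<ge>\<close> k, and put B = b^k, so that I = K + (B)
  and J = K + (B^2). If w B = c + y B^2 with c in K, then w - y B is in X; thus J : I is spanned
  by X and B. Stability, in the form that B^2 y in K implies B y in K, makes the sum direct modulo J.
  It also keeps a z outside K with b z in K out of I, and this z satisfies z B in K, so z is the
  element outside I that kills the class of B. Finally B is not in J, for B = c + s B^2 would give
  (1 - s B) B in K.
\<close>

lemma (in noetherian_local_ring) zero_divisor_hom_decomposable_not_free:
  assumes K: "ideal K R" and b: "b \<in> \<mm>"
    and zd: "\<not> nonzerodivisor_mod R K b" and nonnil: "\<And>n::nat. b [^] n \<notin> K"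
  obtains k :: nat where "0 < k"
    "decomposable (R Quot adjoin K (b [^] k))
       (descend (hom_module R (quot_module R (adjoin K (b [^] k))) (quot_module R (adjoin K (b [^] (2 * k))))))"
    "\<not> free_module (R Quot adjoin K (b [^] k))
       (descend (hom_module R (quot_module R (adjoin K (b [^] k))) (quot_module R (adjoin K (b [^] (2 * k))))))"
proof -
  note K' = ideal_closed[OF K]
  have bc: "b \<in> carrier R" and bp: "b [^] n \<in> carrier R" for n :: nat using b by auto
  define L where "L n = {y \<in> carrier R. b [^] (n::nat) \<otimes> y \<in> K}" for n
  have Lid: "ideal (L n) R" for n unfolding L_def by (rule ideal_colon[OF K bp])
  have Lmono: "L n \<subseteq> L (Suc n)" for n
  proof
    fix y assume y: "y \<in> L n"
    then have "b \<otimes> (b [^] n \<otimes> y) \<in> K" using K' bc by (auto simp: L_def)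
    also have "b \<otimes> (b [^] n \<otimes> y) = b [^] Suc n \<otimes> y" using y bc bp by (simp add: L_def m_ac)
    finally show "y \<in> L (Suc n)" using y by (auto simp: L_def)
  qed
  obtain e where e: "\<And>n. n \<ge> e \<Longrightarrow> L n = L e"
    using ideal_seq_stabilizes[of L, OF Lid Lmono] by blast
  define k where "k = Suc e"
  define B where "B = b [^] k"
  have Bc: "B \<in> carrier R" using bp by (simp add: B_def)
  have B2: "b [^] (2 * k) = B \<otimes> B" using nat_pow_mult[OF bc, of k k] by (simp add: B_def mult_2)
  have LK: "B \<otimes> y \<in> K" if "y \<in> carrier R" "B \<otimes> (B \<otimes> y) \<in> K" for y
  proof -
    have "b [^] (2 * k) \<otimes> y \<in> K" unfolding B2 using that Bc by (simp add: m_assoc)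
    then have "y \<in> L (2 * k)" using that by (simp add: L_def)
    then have "y \<in> L k" using e[of k] e[of "2 * k"] by (simp add: k_def)
    then show ?thesis by (simp add: L_def B_def)
  qed
  obtain z where z: "z \<in> carrier R" "b \<otimes> z \<in> K" "z \<notin> K" using zd by (auto simp: nonzerodivisor_mod_def)
  have Bz: "B \<otimes> z \<in> K"
  proof -
    have "B \<otimes> z = b [^] e \<otimes> (b \<otimes> z)" unfolding B_def k_def using bc bp z(1) by (simp add: m_assoc)
    then show ?thesis using K'(6)[OF z(2) bp] by simp
  qed
  let ?I = "adjoin K B" and ?J = "adjoin K (B \<otimes> B)"
  have I: "ideal ?I R" and J: "ideal ?J R" using ideal_adjoin[OF K] Bc by auto
  note I' = ideal_closed[OF I] and J' = ideal_closed[OF J]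
  have KJ: "K \<subseteq> ?J" and BBJ: "B \<otimes> B \<in> ?J" and KI: "K \<subseteq> ?I" and BI: "B \<in> ?I"
    using subset_adjoin[OF K] Bc by auto
  have JI: "?J \<subseteq> ?I" by (rule adjoin_subset[OF I KI]) (use I'(6)[OF BI Bc] in simp)
  define X where "X = {y \<in> carrier R. B \<otimes> y \<in> K}"
  have X: "ideal X R" unfolding X_def by (rule ideal_colon[OF K Bc])
  have zI: "z \<notin> ?I"
  proof
    assume "z \<in> ?I"
    then obtain c s where cs: "c \<in> K" "s \<in> carrier R" "z = c \<oplus> s \<otimes> B" by (auto simp: mem_adjoin_iff)
    have cc: "c \<in> carrier R" using cs K' by blast
    have "B \<otimes> (B \<otimes> s) = B \<otimes> z \<ominus> B \<otimes> c" unfolding cs(3) using cc cs(2) Bc by algebra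
    also have "\<dots> \<in> K" using K'(5)[OF Bz K'(6)[OF cs(1) Bc]] .
    finally have "B \<otimes> s \<in> K" by (rule LK[OF cs(2)])
    then have "z \<in> K" unfolding cs(3) using K'(3)[OF cs(1)] cs(2) Bc by (simp add: m_comm)
    then show False using z by simp
  qed
  let ?M = "{z \<in> carrier R. \<forall>x\<in>?I. x \<otimes> z \<in> ?J}"
  have XM: "X \<subseteq> ?M"
  proof
    fix x assume x: "x \<in> X"
    then have xc: "x \<in> carrier R" and Bx: "B \<otimes> x \<in> K" by (auto simp: X_def)
    have "i \<otimes> x \<in> ?J" if "i \<in> ?I" for i
    proof -
      obtain c s where cs: "c \<in> K" "s \<in> carrier R" "i = c \<oplus> s \<otimes> B" using \<open>i \<in> ?I\<close> by (auto simp: mem_adjoin_iff)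
      have cc: "c \<in> carrier R" using cs K' by blast
      have "i \<otimes> x = c \<otimes> x \<oplus> s \<otimes> (B \<otimes> x)" unfolding cs(3) using cc cs(2) Bc xc by algebra
      also have "\<dots> \<in> K" using K'(3)[OF K'(7)[OF cs(1) xc] K'(6)[OF Bx cs(2)]] .
      finally show ?thesis using KJ by blast
    qed
    then show "x \<in> ?M" using xc by blast
  qed
  have BM: "B \<in> ?M"
  proof -
    have "i \<otimes> B \<in> ?J" if "i \<in> ?I" for i
    proof -
      obtain c s where cs: "c \<in> K" "s \<in> carrier R" "i = c \<oplus> s \<otimes> B" using \<open>i \<in> ?I\<close> by (auto simp: mem_adjoin_iff)
      have cc: "c \<in> carrier R" using cs K' by blast
      have "i \<otimes> B = c \<otimes> B \<oplus> s \<otimes> (B \<otimes> B)" unfolding cs(3) using cc cs(2) Bc by algebra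
      then show ?thesis using mem_adjoinI K'(7)[OF cs(1) Bc] cs(2) by blast
    qed
    then show ?thesis using Bc by blast
  qed
  have span: "\<exists>x\<in>X. \<exists>y\<in>carrier R. w \<ominus> (x \<oplus> y \<otimes> B) \<in> ?J" if w: "w \<in> ?M" for w
  proof -
    have wc: "w \<in> carrier R" and "B \<otimes> w \<in> ?J" using w BI by blast+
    then obtain c y where cy: "c \<in> K" "y \<in> carrier R" "B \<otimes> w = c \<oplus> y \<otimes> (B \<otimes> B)" by (auto simp: mem_adjoin_iff)
    have cc: "c \<in> carrier R" using cy K' by blast
    have "B \<otimes> (w \<ominus> y \<otimes> B) = B \<otimes> w \<ominus> y \<otimes> (B \<otimes> B)" using wc cy(2) Bc by algebra
    also have "\<dots> = c" unfolding cy(3) using cc cy(2) Bc by algebra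
    finally have "w \<ominus> y \<otimes> B \<in> X" using cy Bc wc by (simp add: X_def)
    moreover have "w \<ominus> ((w \<ominus> y \<otimes> B) \<oplus> y \<otimes> B) = \<zero>" using wc cy(2) Bc by algebra
    ultimately show ?thesis using cy(2) J'(2) by metis
  qed
  have indep: "y \<otimes> B \<in> ?J" if x: "x \<in> X" and y: "y \<in> carrier R" and yx: "y \<otimes> B \<ominus> x \<in> ?J" for x y
  proof -
    have xc: "x \<in> carrier R" and Bx: "B \<otimes> x \<in> K" using x by (auto simp: X_def)
    obtain c s where cs: "c \<in> K" "s \<in> carrier R" "y \<otimes> B \<ominus> x = c \<oplus> s \<otimes> (B \<otimes> B)"
      using yx by (auto simp: mem_adjoin_iff)
    have cc: "c \<in> carrier R" using cs K' by blast
    have "B \<otimes> (B \<otimes> (y \<ominus> s \<otimes> B)) = B \<otimes> (y \<otimes> B \<ominus> x) \<ominus> B \<otimes> (s \<otimes> (B \<otimes> B)) \<oplus> B \<otimes> x"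
      using xc y cs(2) Bc by algebra
    also have "\<dots> = B \<otimes> c \<oplus> B \<otimes> x" unfolding cs(3) using xc cc cs(2) Bc by algebra
    also have "\<dots> \<in> K" using K'(3)[OF K'(6)[OF cs(1) Bc] Bx] .
    finally have "B \<otimes> (y \<ominus> s \<otimes> B) \<in> K" by (rule LK[rotated]) (use y cs Bc in auto)
    moreover have "y \<otimes> B = B \<otimes> (y \<ominus> s \<otimes> B) \<oplus> s \<otimes> (B \<otimes> B)" using y cs(2) Bc by algebra
    ultimately show ?thesis using mem_adjoinI cs(2) by blast
  qed
  have BJ: "B \<notin> ?J"
  proof
    assume "B \<in> ?J"
    then obtain c s where cs: "c \<in> K" "s \<in> carrier R" "B = c \<oplus> s \<otimes> (B \<otimes> B)" by (auto simp: mem_adjoin_iff)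
    have cc: "c \<in> carrier R" using cs K' by blast
    have "(\<one> \<ominus> s \<otimes> B) \<otimes> B = B \<ominus> s \<otimes> (B \<otimes> B)"
      using cs(2) Bc by (simp add: minus_eq l_distr l_minus m_assoc)
    also have "\<dots> = (c \<oplus> s \<otimes> (B \<otimes> B)) \<ominus> s \<otimes> (B \<otimes> B)" using cs(3) by simp
    also have "\<dots> = c" using cc cs(2) Bc by algebra
    finally have "(\<one> \<ominus> s \<otimes> B) \<otimes> B \<in> K" using cs by simp
    moreover have "B \<in> \<mm>" using \<mm>.I_l_closed[OF b bp, of e] by (simp add: B_def k_def)
    then have "\<one> \<ominus> s \<otimes> B \<notin> \<mm>" using one_minus_notin_max \<mm>.I_l_closed cs(2) by blast
    ultimately have "B \<in> K" using mem_of_unit_mult[OF K _ Bc, of "\<one> \<ominus> s \<otimes> B"] cs(2) Bc by simp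
    then show False using nonnil by (simp add: B_def)
  qed
  have XJ: "\<not> X \<subseteq> ?J" using zI JI Bz z(1) unfolding X_def by blast
  have zB: "z \<otimes> B \<in> ?J" using Bz KJ z(1) Bc m_comm by auto
  have "decomposable (R Quot ?I) (descend (hom_module R (quot_module R ?I) (quot_module R ?J)))"
    by (rule hom_quot_decomposable_not_free(1)[OF I J X XM BM _ _ XJ BJ z(1) zI zB]) (fact span indep)+
  moreover have "\<not> free_module (R Quot ?I) (descend (hom_module R (quot_module R ?I) (quot_module R ?J)))"
    by (rule hom_quot_decomposable_not_free(2)[OF I J X XM BM _ _ XJ BJ z(1) zI zB]) (fact span indep)+
  moreover have "0 < k" by (simp add: k_def)
  ultimately show thesis using that[of k] unfolding B2 B_def[symmetric] by blast
qed

theorem theorem4p2: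
  fixes R :: "('a, 'r) ring_scheme" and d :: nat and a :: "nat \<Rightarrow> 'a"
  assumes "local_ring R" and "noetherian_ring R" and "krull_dim R = enat d"
    and "\<not> cohen_macaulay R"
    and "system_of_parameters R d a"
  shows "\<exists>n N :: nat \<Rightarrow> nat.
      (\<forall>i\<in>{1..d}. 0 < n i \<and> n i \<le> N i) \<and>
      (let I = power_ideal R d a n; J = power_ideal R d a N;
           H = descend (hom_module R (quot_module R I) (quot_module R J))
       in decomposable (R Quot I) H \<and> \<not> free_module (R Quot I) H)"
proof -
  obtain m where m: "maximalideal m R" "\<And>J. maximalideal J R \<Longrightarrow> J = m"
    using assms(1) unfolding local_ring_def by blast
  interpret cring R using assms(1) by (simp add: local_ring_def)
  interpret noetherian_ring R by (rule assms)
  interpret noetherian_local_ring R m 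
    by (intro noetherian_local_ring.intro noetherian_local_ring_axioms.intro noetherian_cring.intro
        cring_axioms noetherian_ring_axioms m)
  have am: "a ` {1..d} \<subseteq> m"
    and fl: "finite_length R (quot_module R (Idl\<^bsub>R\<^esub> (a ` {1..d})))"
    using assms(5) unfolding system_of_parameters_def max_ideal_eq by auto
  obtain i and n :: "nat \<Rightarrow> nat" where i: "i \<in> {1..d}" and n: "\<And>j. 0 < n j"
    and zd: "\<not> nonzerodivisor_mod R (Idl\<^bsub>R\<^esub> ((\<lambda>j. a j [^]\<^bsub>R\<^esub> n j) ` ({1..d} - {i}))) (a i)"
    using cohen_macaulayI[OF assms(3) am] assms(4) by blast
  define S where "S = (\<lambda>j. a j [^]\<^bsub>R\<^esub> n j) ` ({1..d} - {i})"
  have S: "S \<subseteq> carrier R" using am \<mm>.Icarr by (auto simp: S_def)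
  have "a i \<in> m" using am i by auto
  then have ai: "a i \<in> m" "a i \<in> carrier R" by auto
  have pow: "power_ideal R d a (n(i := k)) = adjoin (Idl\<^bsub>R\<^esub> S) (a i [^]\<^bsub>R\<^esub> k)" for k
  proof -
    have "(\<lambda>j. a j [^]\<^bsub>R\<^esub> (n(i := k)) j) ` {1..d} = insert (a i [^]\<^bsub>R\<^esub> k) S"
    proof -
      have "{1..d} = insert i ({1..d} - {i})" using i by blast
      then have "(\<lambda>j. a j [^]\<^bsub>R\<^esub> (n(i := k)) j) ` {1..d}
          = insert (a i [^]\<^bsub>R\<^esub> k) ((\<lambda>j. a j [^]\<^bsub>R\<^esub> (n(i := k)) j) ` ({1..d} - {i}))"
        by (metis (no_types, lifting) fun_upd_same image_insert)
      also have "(\<lambda>j. a j [^]\<^bsub>R\<^esub> (n(i := k)) j) ` ({1..d} - {i}) = S"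
        unfolding S_def by (rule image_cong) auto
      finally show ?thesis .
    qed
    then show ?thesis unfolding power_ideal_def using genideal_insert[OF S] ai(2) by simp
  qed
  have nonnil: "a i [^]\<^bsub>R\<^esub> (e::nat) \<notin> Idl\<^bsub>R\<^esub> S" for e
    unfolding S_def by (rule parameter_not_nilpotent_mod[OF assms(3) am fl i n])
  obtain k :: nat where k: "0 < k"
    "decomposable (R Quot power_ideal R d a (n(i := k)))
       (descend (hom_module R (quot_module R (power_ideal R d a (n(i := k))))
         (quot_module R (power_ideal R d a (n(i := 2 * k))))))"
    "\<not> free_module (R Quot power_ideal R d a (n(i := k)))
       (descend (hom_module R (quot_module R (power_ideal R d a (n(i := k))))
         (quot_module R (power_ideal R d a (n(i := 2 * k))))))"
    using zero_divisor_hom_decomposable_not_free[OF genideal_ideal[OF S] ai(1) zd[folded S_def] nonnil]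
    unfolding pow by blast
  show ?thesis
    by (rule exI[of _ "n(i := k)"], rule exI[of _ "n(i := 2 * k)"]) (use k n in \<open>auto simp: Let_def\<close>)
qed

end
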